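(* Let $s_0=\lceil\log_2\log_2 4n\rceil$ and $c=\frac32$, and run the algorithm VRAE (described in the context; it uses the smoothness parameter $\beta$) with the parameters $$a^{(s)}=\begin{cases}(4n)^{-0.5^{s}} & 1\le s\le s_0\\ \frac{s-s_0-1+c}{2c} & s>s_0\end{cases},\qquad T_s=n,\qquad A_{T_0}^{(0)}=\frac54,$$ where $(4n)^{-0.5^s}$ means $(4n)^{-(0.5^s)}$. Set $V=\frac52\left(F(u^{(0)})-F(x^* )\right)+8\beta\left\|u^{(0)}-x^*\right\|^2$. Then for every $\epsilon>0$ there is a number of epochs $S\ge1$ such that the output satisfies $\mathbb E\left[F(u^{(S)})-F(x^* )\right]\le\epsilon$ and the number of gradient evaluations used is $$\#grads=\begin{cases}\mathcal O\left(n\log\log\frac V\epsilon\right)&\text{if }\epsilon\ge\frac Vn\\[2pt] \mathcal O\left(n\log\log n+\sqrt{\frac{Vn}{\epsilon}}\right)&\text{if }\epsilon<\frac Vn\end{cases}.$$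
   Context: Problem. $n,d\ge1$ are integers, $\mathcal X\subseteq\mathbb R^d$ is a nonempty closed convex set (not assumed bounded), $f_1,\dots,f_n:\mathbb R^d\to\mathbb R$ are convex, differentiable and $\beta$-smooth with $\beta>0$, i.e. $\|\nabla f_i(x)-\nabla f_i(y)\|\le\beta\|x-y\|$ for all $x,y\in\mathbb R^d$; $f=\frac1n\sum_{i=1}^n f_i$; $h:\mathcal X\to\mathbb R$ is convex, possibly nonsmooth, and such that $\arg\min_{x\in\mathcal X}(\lambda h(x)+\frac12\|x-v\|^2)$ exists for all $\lambda\ge0$, $v\in\mathbb R^d$. $F=f+h$ and $x^*\in\arg\min_{x\in\mathcal X}F(x)$ (assumed to exist). $\|\cdot\|$ is the Euclidean norm. Algorithm VRAE. Input $u^{(0)}\in\mathcal X$ and $\beta$. Parameters: $a^{(s)}>0$, positive integers $T_s$ ($s\ge1$), $A_{T_0}^{(0)}>0$. Initialize $\overline x_0^{(1)}=z_0^{(1)}=u^{(0)}$, $g_0^{(1)}=\nabla f(u^{(0)})$. For $s=1,\dots,S$: set $A_0^{(s)}=A_{T_{s-1}}^{(s-1)}-T_s(a^{(s)})^2$; for $t=1,\dots,T_s$: - $x_t^{(s)}=\arg\min_{x\in\mathcal X}\{a^{(s)}\langle g_{t-1}^{(s)},x\rangle+a^{(s)}h(x)+4\beta\|x-z_{t-1}^{(s)}\|^2\}$; - $A_t^{(s)}=A_{t-1}^{(s)}+a^{(s)}+(a^{(s)})^2$ and $\overline x_t^{(s)}=\frac1{A_t^{(s)}}\left(A_{t-1}^{(s)}\overline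 x_{t-1}^{(s)}+a^{(s)}x_t^{(s)}+(a^{(s)})^2u^{(s-1)}\right)$; - if $t\ne T_s$: draw $i_t^{(s)}$ uniformly from $\{1,\dots,n\}$, independently of everything before, and set $g_t^{(s)}=\nabla f_{i_t^{(s)}}(\overline x_t^{(s)})-\nabla f_{i_t^{(s)}}(u^{(s-1)})+\nabla f(u^{(s-1)})$; if $t=T_s$: $g_t^{(s)}=\nabla f(\overline x_t^{(s)})$; - $z_t^{(s)}=\arg\min_{z\in\mathcal X}\{a^{(s)}\langle g_t^{(s)},z\rangle+a^{(s)}h(z)+4\beta\|z-z_{t-1}^{(s)}\|^2\}$. At the end of epoch $s$: $u^{(s)}=\overline x_0^{(s+1)}=\overline x_{T_s}^{(s)}$, $z_0^{(s+1)}=z_{T_s}^{(s)}$, $g_0^{(s+1)}=g_{T_s}^{(s)}$. Output $u^{(S)}$. Counting. An evaluation of some $\nabla f_i$ at a point counts as one gradient evaluation; computing $\nabla f$ at a point counts as $n$. $\mathcal O(\cdot)$ hides absolute constants; iterated logarithms $\log\log(\cdot)$ inside $\mathcal O$ are read as $\max\{1,\log\log(\cdot)\}$ (and as $1$ when undefined). *)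

theory Defs
  imports "HOL-Probability.Probability"
begin

section \<open>The spaces $R^d$ with $d$ a value\<close>

text \<open>
  An absolute constant must not depend on the dimension, so it has to be quantified before
  \<^term>\<open>d\<close>; with the dimension in a type this is impossible.  All spaces $R^d$ are therefore taken
  as subspaces of one inner product space, the finitely supported real sequences with the
  Euclidean inner product.
\<close>

typedef evec = "{x :: nat \<Rightarrow> real. finite {i. x i \<noteq> 0}}"
  morphisms coord Abs_evec
  by (rule exI[of _ "\<lambda>_. 0"]) simp

setup_lifting type_definition_evec

lemma finite_coord: "finite {i. coord x i \<noteq> 0}"
  using coord[of x] by simp

lemma evec_eqI: "(\<And>i. coord x i = coord y i) \<Longrightarrow> x = y"
  using coord_inject by blast

instantiation evec :: real_vector
begin

lift_definition zero_evec :: evec is "\<lambda>_. 0" by simp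

lift_definition plus_evec :: "evec \<Rightarrow> evec \<Rightarrow> evec" is "\<lambda>x y i. x i + y i"
proof -
  fix x y :: "nat \<Rightarrow> real"
  assume "finite {i. x i \<noteq> 0}" "finite {i. y i \<noteq> 0}"
  then show "finite {i. x i + y i \<noteq> 0}"
    by (rule_tac finite_subset[of _ "{i. x i \<noteq> 0} \<union> {i. y i \<noteq> 0}"]) auto
qed

lift_definition minus_evec :: "evec \<Rightarrow> evec \<Rightarrow> evec" is "\<lambda>x y i. x i - y i"
proof -
  fix x y :: "nat \<Rightarrow> real"
  assume "finite {i. x i \<noteq> 0}" "finite {i. y i \<noteq> 0}"
  then show "finite {i. x i - y i \<noteq> 0}"
    by (rule_tac finite_subset[of _ "{i. x i \<noteq> 0} \<union> {i. y i \<noteq> 0}"]) auto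
qed

lift_definition uminus_evec :: "evec \<Rightarrow> evec" is "\<lambda>x i. - x i" by simp

lift_definition scaleR_evec :: "real \<Rightarrow> evec \<Rightarrow> evec" is "\<lambda>r x i. r * x i"
  by (erule rev_finite_subset) auto

instance
proof
  fix x y z :: evec and r s :: real
  show "x + y + z = x + (y + z)" by transfer auto
  show "x + y = y + x" by transfer auto
  show "0 + x = x" by transfer auto
  show "- x + x = 0" by transfer auto
  show "x - y = x + - y" by transfer auto
  show "r *\<^sub>R (x + y) = r *\<^sub>R x + r *\<^sub>R y" by transfer (auto simp: algebra_simps)
  show "(r + s) *\<^sub>R x = r *\<^sub>R x + s *\<^sub>R x" by transfer (auto simp: algebra_simps)
  show "r *\<^sub>R s *\<^sub>R x = (r * s) *\<^sub>R x" by transfer (auto simp: algebra_simps)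
  show "1 *\<^sub>R x = x" by transfer auto
qed

end

instantiation evec :: real_inner
begin

definition inner_evec :: "evec \<Rightarrow> evec \<Rightarrow> real" where
  "inner x y = (\<Sum>i | coord x i \<noteq> 0. coord x i * coord y i)"

definition norm_evec :: "evec \<Rightarrow> real" where
  "norm x = sqrt (inner x x)" for x :: evec

definition sgn_evec :: "evec \<Rightarrow> evec" where
  "sgn x = x /\<^sub>R norm x" for x :: evec

definition dist_evec :: "evec \<Rightarrow> evec \<Rightarrow> real" where
  "dist x y = norm (x - y)" for x y :: evec

definition uniformity_evec :: "(evec \<times> evec) filter" where
  "uniformity_evec = (INF e\<in>{0<..}. principal {(x, y). dist x y < e})"

definition open_evec :: "evec set \<Rightarrow> bool" where
  "open_evec U \<longleftrightarrow> (\<forall>x\<in>U. eventually (\<lambda>(x', y). x' = x \<longrightarrow> y \<in> U) uniformity)"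

lemma inner_evec_superset:
  assumes "finite I" "{i. coord x i \<noteq> 0} \<subseteq> I"
  shows "inner x y = (\<Sum>i\<in>I. coord x i * coord y i)"
  unfolding inner_evec_def using assms by (intro sum.mono_neutral_left) auto

instance
proof
  fix x y z :: evec and r :: real
  let ?I = "{i. coord x i \<noteq> 0} \<union> {i. coord y i \<noteq> 0} \<union> {i. coord z i \<noteq> 0}"
  have fin: "finite ?I"
    using finite_coord by blast
  show "sgn x = x /\<^sub>R norm x" by (rule sgn_evec_def)
  show "dist x y = norm (x - y)" by (rule dist_evec_def)
  show "uniformity = (INF e\<in>{0<..}. principal {(x, y :: evec). dist x y < e})"
    by (rule uniformity_evec_def)
  show "open U \<longleftrightarrow> (\<forall>x\<in>U. eventually (\<lambda>(x', y). x' = x \<longrightarrow> y \<in> U) uniformity)" for U :: "evec set"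
    by (rule open_evec_def)
  have sx: "{i. coord x i \<noteq> 0} \<subseteq> ?I" and sy: "{i. coord y i \<noteq> 0} \<subseteq> ?I"
    and sxy: "{i. coord (x + y) i \<noteq> 0} \<subseteq> ?I" and sr: "{i. coord (r *\<^sub>R x) i \<noteq> 0} \<subseteq> ?I"
    by (auto simp: plus_evec.rep_eq scaleR_evec.rep_eq)
  show "inner x y = inner y x"
    unfolding inner_evec_superset[OF fin sx] inner_evec_superset[OF fin sy]
    by (simp add: mult.commute)
  show "inner (x + y) z = inner x z + inner y z"
    unfolding inner_evec_superset[OF fin sx] inner_evec_superset[OF fin sy]
      inner_evec_superset[OF fin sxy]
    by (simp only: plus_evec.rep_eq distrib_right sum.distrib)
  show "inner (r *\<^sub>R x) y = r * inner x y"
    unfolding inner_evec_superset[OF fin sx] inner_evec_superset[OF fin sr]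
    by (simp only: scaleR_evec.rep_eq sum_distrib_left mult.assoc)
  show "0 \<le> inner x x"
    by (simp add: inner_evec_def sum_nonneg)
  show "inner x x = 0 \<longleftrightarrow> x = 0"
  proof
    assume "inner x x = 0"
    then have "coord x i = 0" for i
      unfolding inner_evec_def using finite_coord[of x]
      by (subst (asm) sum_nonneg_eq_0_iff) auto
    then show "x = 0"
      by (intro evec_eqI) (simp add: zero_evec.rep_eq)
  qed (simp add: inner_evec_def zero_evec.rep_eq)
  show "norm x = sqrt (inner x x)" by (rule norm_evec_def)
qed

end

definition euclid :: "nat \<Rightarrow> evec set" where
  "euclid d = {x. \<forall>i\<ge>d. coord x i = 0}"

text \<open>Sanity checks: \<^term>\<open>euclid d\<close> is a \<^term>\<open>d\<close>-dimensional subspace carrying the usual inner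
  product and norm, and is closed in the ambient space, so that closedness of a subset does not
  depend on which of the two spaces it is taken in.\<close>

lemma subspace_euclid: "subspace (euclid d)"
  by (auto simp: subspace_def euclid_def zero_evec.rep_eq plus_evec.rep_eq scaleR_evec.rep_eq)

lemma inner_euclid:
  assumes "x \<in> euclid d"
  shows "inner x y = (\<Sum>i<d. coord x i * coord y i)"
proof (rule inner_evec_superset)
  show "{i. coord x i \<noteq> 0} \<subseteq> {..<d}"
    using assms by (auto simp: euclid_def) (meson not_less)
qed simp

lemma norm_euclid:
  assumes "x \<in> euclid d"
  shows "norm x = sqrt (\<Sum>i<d. (coord x i)\<^sup>2)"
  using inner_euclid[OF assms, of x] by (simp add: norm_eq_sqrt_inner power2_eq_square)

lift_definition unit_evec :: "nat \<Rightarrow> evec" is "\<lambda>k i. if i = k then 1 else 0" by simp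

lemma inner_unit_evec: "inner (unit_evec k) x = coord x k"
  using inner_evec_superset[of "{k}" "unit_evec k" x] by (auto simp: unit_evec.rep_eq)

lemma coord_sum: "coord (sum g A) i = (\<Sum>a\<in>A. coord (g a) i)"
  by (induction A rule: infinite_finite_induct) (auto simp: zero_evec.rep_eq plus_evec.rep_eq)

lemma dim_euclid: "dim (euclid d) = d"
proof -
  let ?B = "unit_evec ` {..<d}"
  have inj: "inj_on unit_evec {..<d}"
    by (rule inj_onI) (metis inner_unit_evec unit_evec.rep_eq zero_neq_one)
  have "independent ?B"
  proof (rule pairwise_orthogonal_independent)
    show "pairwise orthogonal ?B"
      by (auto simp: pairwise_def orthogonal_def inner_unit_evec unit_evec.rep_eq)
    show "0 \<notin> ?B"
      by (metis imageE inner_unit_evec inner_zero_right unit_evec.rep_eq zero_neq_one)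
  qed
  moreover have "?B \<subseteq> euclid d"
    by (auto simp: euclid_def unit_evec.rep_eq)
  moreover have "euclid d \<subseteq> span ?B"
  proof
    fix x assume x: "x \<in> euclid d"
    have "x = (\<Sum>k<d. coord x k *\<^sub>R unit_evec k)"
    proof (rule evec_eqI)
      fix i
      have "(\<Sum>k<d. coord x k * (if i = k then 1 else 0)) = (if i < d then coord x i else 0)"
        by (simp add: if_distrib cong: if_cong)
      then show "coord x i = coord (\<Sum>k<d. coord x k *\<^sub>R unit_evec k) i"
        using x by (auto simp: coord_sum scaleR_evec.rep_eq unit_evec.rep_eq euclid_def not_less)
    qed
    also have "\<dots> \<in> span ?B"
      by (intro span_sum span_scale span_base) auto
    finally show "x \<in> span ?B" .
  qed
  ultimately have "card ?B = dim (euclid d)"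
    by (intro basis_card_eq_dim)
  then show ?thesis
    using inj by (simp add: card_image)
qed

lemma closed_euclid: "closed (euclid d)"
proof -
  have "euclid d = (\<Inter>i\<in>{d..}. {x. inner (unit_evec i) x = 0})"
    by (auto simp: euclid_def inner_unit_evec)
  then show ?thesis
    by (auto intro!: closed_INT closed_Collect_eq continuous_intros)
qed


section \<open>The composite finite-sum problem\<close>

text \<open>Functions on $R^d$ are total functions of which only the values on \<^term>\<open>euclid d\<close>
  matter, so derivatives are taken within that subspace; for \<^term>\<open>d \<ge> 1\<close> a function
  differentiable at a point of \<^term>\<open>euclid d\<close> has exactly one gradient there.\<close>

definition grad :: "nat \<Rightarrow> (evec \<Rightarrow> real) \<Rightarrow> evec \<Rightarrow> evec" where
  "grad d \<phi> x = (THE g. g \<in> euclid d \<and> (\<phi> has_derivative (\<lambda>v. inner g v)) (at x within euclid d))"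

definition favg :: "nat \<Rightarrow> (nat \<Rightarrow> evec \<Rightarrow> real) \<Rightarrow> evec \<Rightarrow> real" where
  "favg n f x = (\<Sum>i=1..n. f i x) / real n"

definition objective :: "nat \<Rightarrow> (nat \<Rightarrow> evec \<Rightarrow> real) \<Rightarrow> (evec \<Rightarrow> real) \<Rightarrow> evec \<Rightarrow> real" where
  "objective n f h x = favg n f x + h x"

definition beta_smooth :: "nat \<Rightarrow> real \<Rightarrow> (evec \<Rightarrow> real) \<Rightarrow> bool" where
  "beta_smooth d \<beta> \<phi> \<longleftrightarrow> \<phi> differentiable_on euclid d \<and>
     (\<forall>x\<in>euclid d. \<forall>y\<in>euclid d. norm (grad d \<phi> x - grad d \<phi> y) \<le> \<beta> * norm (x - y))"

definition problem ::
  "nat \<Rightarrow> nat \<Rightarrow> evec set \<Rightarrow> (nat \<Rightarrow> evec \<Rightarrow> real) \<Rightarrow> (evec \<Rightarrow> real) \<Rightarrow> real \<Rightarrow> bool" where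
  "problem d n X f h \<beta> \<longleftrightarrow>
     d \<ge> 1 \<and> n \<ge> 1 \<and> \<beta> > 0 \<and>
     X \<subseteq> euclid d \<and> X \<noteq> {} \<and> closed X \<and> convex X \<and>
     (\<forall>i\<in>{1..n}. convex_on (euclid d) (f i) \<and> beta_smooth d \<beta> (f i)) \<and>
     convex_on X h \<and>
     (\<forall>l\<ge>0. \<forall>v\<in>euclid d.
        \<exists>x. is_arg_min (\<lambda>x. l * h x + 1 / 2 * (norm (x - v))\<^sup>2) (\<lambda>x. x \<in> X) x)"


section \<open>Algorithm VRAE\<close>

text \<open>The iterate after step $t$ of an epoch, together with the number of component gradients
  evaluated so far.\<close>

record vrae_state =
  xbar :: evec
  zpt :: evec
  gvec :: evec
  Acoef :: real
  ngrads :: nat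

text \<open>The objective is strictly convex, so for a problem as above the minimizer is unique.\<close>

definition prox_step ::
  "evec set \<Rightarrow> (evec \<Rightarrow> real) \<Rightarrow> real \<Rightarrow> real \<Rightarrow> evec \<Rightarrow> evec \<Rightarrow> evec" where
  "prox_step X h \<beta> a g z =
     arg_min_on (\<lambda>x. a * inner g x + a * h x + 4 * \<beta> * (norm (x - z))\<^sup>2) X"

text \<open>Step $t$ of an epoch of length \<^term>\<open>T\<close> with reference point \<^term>\<open>u\<close>.  The vector
  $\nabla f(u)$ is the $g_0$ of the epoch and was charged when that was computed, so an inner step
  evaluates two component gradients.\<close>

definition vrae_step ::
  "nat \<Rightarrow> nat \<Rightarrow> evec set \<Rightarrow> (nat \<Rightarrow> evec \<Rightarrow> real) \<Rightarrow> (evec \<Rightarrow> real) \<Rightarrow> real \<Rightarrow>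
   real \<Rightarrow> nat \<Rightarrow> evec \<Rightarrow> nat \<Rightarrow> vrae_state \<Rightarrow> vrae_state pmf" where
  "vrae_step d n X f h \<beta> a T u t st =
     (let x = prox_step X h \<beta> a (gvec st) (zpt st);
          A' = Acoef st + a + a\<^sup>2;
          xb = (1 / A') *\<^sub>R (Acoef st *\<^sub>R xbar st + a *\<^sub>R x + a\<^sup>2 *\<^sub>R u);
          next_state = (\<lambda>g k. \<lparr>xbar = xb, zpt = prox_step X h \<beta> a g (zpt st), gvec = g,
                               Acoef = A', ngrads = ngrads st + k\<rparr>)
      in if t \<noteq> T
         then map_pmf
           (\<lambda>i. next_state (grad d (f i) xb - grad d (f i) u + grad d (favg n f) u) 2)
           (pmf_of_set {1..n})
         else return_pmf (next_state (grad d (favg n f) xb) n))"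

primrec vrae_inner ::
  "nat \<Rightarrow> nat \<Rightarrow> evec set \<Rightarrow> (nat \<Rightarrow> evec \<Rightarrow> real) \<Rightarrow> (evec \<Rightarrow> real) \<Rightarrow> real \<Rightarrow>
   real \<Rightarrow> nat \<Rightarrow> evec \<Rightarrow> nat \<Rightarrow> vrae_state \<Rightarrow> vrae_state pmf" where
  "vrae_inner d n X f h \<beta> a T u 0 st = return_pmf st"
| "vrae_inner d n X f h \<beta> a T u (Suc t) st =
     bind_pmf (vrae_inner d n X f h \<beta> a T u t st) (vrae_step d n X f h \<beta> a T u (Suc t))"

definition vrae_epoch ::
  "nat \<Rightarrow> nat \<Rightarrow> evec set \<Rightarrow> (nat \<Rightarrow> evec \<Rightarrow> real) \<Rightarrow> (evec \<Rightarrow> real) \<Rightarrow> real \<Rightarrow>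
   real \<Rightarrow> nat \<Rightarrow> vrae_state \<Rightarrow> vrae_state pmf" where
  "vrae_epoch d n X f h \<beta> a T st =
     vrae_inner d n X f h \<beta> a T (xbar st) T (st\<lparr>Acoef := Acoef st - real T * a\<^sup>2\<rparr>)"

text \<open>The law of the state after \<^term>\<open>S\<close> epochs; the output $u^{(S)}$ is its \<^const>\<open>xbar\<close>.\<close>

primrec vrae ::
  "nat \<Rightarrow> nat \<Rightarrow> evec set \<Rightarrow> (nat \<Rightarrow> evec \<Rightarrow> real) \<Rightarrow> (evec \<Rightarrow> real) \<Rightarrow> real \<Rightarrow>
   (nat \<Rightarrow> real) \<Rightarrow> (nat \<Rightarrow> nat) \<Rightarrow> real \<Rightarrow> evec \<Rightarrow> nat \<Rightarrow> vrae_state pmf" where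
  "vrae d n X f h \<beta> a T A0 u0 0 =
     return_pmf \<lparr>xbar = u0, zpt = u0, gvec = grad d (favg n f) u0, Acoef = A0, ngrads = n\<rparr>"
| "vrae d n X f h \<beta> a T A0 u0 (Suc s) =
     bind_pmf (vrae d n X f h \<beta> a T A0 u0 s)
       (vrae_epoch d n X f h \<beta> (a (Suc s)) (T (Suc s)))"


section \<open>Parameter choice and complexity\<close>

definition s0 :: "nat \<Rightarrow> nat" where
  "s0 n = nat \<lceil>log 2 (log 2 (4 * real n))\<rceil>"

definition a_param :: "nat \<Rightarrow> nat \<Rightarrow> real" where
  "a_param n s =
     (let c = 3 / 2 in
      if s \<le> s0 n then (4 * real n) powr (- ((1 / 2) ^ s))
      else (real s - real (s0 n) - 1 + c) / (2 * c))"

text \<open>The iterated logarithm as it is read inside $O$: cut off below at 1, and 1 where undefined.\<close>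

definition loglog :: "real \<Rightarrow> real" where
  "loglog x = (if x > 1 then max 1 (ln (ln x)) else 1)"

end

theory Submission
  imports Defs
begin

text \<open>
  Within an epoch with step size \<open>a\<close> and anchor \<open>u\<close>, the Lyapunov function
  \<open>A (F(x) - F\<^sup>*) + 4 \<beta> \<parallel>z - x\<^sup>*\<parallel>\<^sup>2 + a\<^sup>2 / (8 \<beta>) \<parallel>g - \<nabla>f(x)\<parallel>\<^sup>2\<close>, taken at the averaged iterate \<open>x\<close>,
  grows by at most \<open>a\<^sup>2 (F(u) - F\<^sup>*)\<close> in expectation per step, provided \<open>a\<^sup>2 \<le> 4 A\<close>: the
  extragradient step leaves an error \<open>a\<^sup>2 / (16 \<beta>) \<parallel>g\<^sub>t - g\<^sub>t\<^sub>-\<^sub>1\<parallel>\<^sup>2\<close>, whose expectation is absorbed by the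
  terms \<open>\<parallel>\<nabla>f\<^sub>i(x) - \<nabla>f\<^sub>i(y)\<parallel>\<^sup>2 / (2 \<beta>)\<close> gained from smoothness and convexity.  Over an epoch the
  growth equals the amount \<open>T a\<^sup>2 (F(u) - F\<^sup>*)\<close> removed at its start, so \<open>E(F(u) - F\<^sup>*) \<le> V / (2 A)\<close>
  after every epoch, where \<open>A = 5/4 + n \<Sum> a\<close>.  This \<open>A\<close> is at least \<open>n (4 n) powr (- 1 / 2 ^ s)\<close> after
  \<open>s \<le> s\<^sub>0\<close> epochs, hence at least \<open>n / 2\<close> after \<open>s\<^sub>0\<close>, and from then on grows quadratically.
\<close>


section \<open>Gradients on a coordinate subspace\<close>

text \<open>The line through \<open>x\<close> in direction \<open>v\<close> stays in the subspace,
  so a derivative within \<open>euclid d\<close> restricts to it. This reduces uniqueness of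
  gradients, convexity and smoothness to calculus in one variable.\<close>

lemma has_real_derivative_line:
  assumes "(\<phi> has_derivative (\<lambda>v. inner g v)) (at (x + t *\<^sub>R v) within euclid d)"
    and "x \<in> euclid d" "v \<in> euclid d"
  shows "((\<lambda>s. \<phi> (x + s *\<^sub>R v)) has_real_derivative inner g v) (at t)"
proof -
  have "range (\<lambda>s. x + s *\<^sub>R v) \<subseteq> euclid d"
    using assms(2,3) subspace_euclid[of d] by (auto intro: subspace_add subspace_scale)
  then have 1: "(\<phi> has_derivative (\<lambda>v. inner g v)) (at (x + t *\<^sub>R v) within range (\<lambda>s. x + s *\<^sub>R v))"
    using assms(1) has_derivative_subset by blast
  have 2: "((\<lambda>s. x + s *\<^sub>R v) has_derivative (\<lambda>s. s *\<^sub>R v)) (at t within UNIV)"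
    by (auto intro!: derivative_eq_intros)
  have "((\<lambda>s. \<phi> (x + s *\<^sub>R v)) has_derivative (\<lambda>s. inner g (s *\<^sub>R v))) (at t)"
    using has_derivative_in_compose[OF 2 1] by simp
  moreover have "(\<lambda>s. inner g (s *\<^sub>R v)) = (*) (inner g v)"
    by (auto simp: fun_eq_iff)
  ultimately show ?thesis
    by (simp add: has_field_derivative_def)
qed

text \<open>Both gradients give the same derivative along \<open>g - g'\<close>, itself a direction
  of the subspace, so the squared norm of \<open>g - g'\<close> is 0.\<close>

lemma gradient_unique:
  assumes "(\<phi> has_derivative (\<lambda>v. inner g v)) (at x within euclid d)"
    and "(\<phi> has_derivative (\<lambda>v. inner g' v)) (at x within euclid d)"
    and "x \<in> euclid d" "g \<in> euclid d" "g' \<in> euclid d"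
  shows "g = g'"
proof -
  have v: "g - g' \<in> euclid d"
    using assms subspace_euclid subspace_diff by blast
  have "inner g (g - g') = inner g' (g - g')"
  proof (rule DERIV_unique)
    show "((\<lambda>s. \<phi> (x + s *\<^sub>R (g - g'))) has_real_derivative inner g (g - g')) (at 0)"
      using assms v by (intro has_real_derivative_line) auto
    show "((\<lambda>s. \<phi> (x + s *\<^sub>R (g - g'))) has_real_derivative inner g' (g - g')) (at 0)"
      using assms v by (intro has_real_derivative_line) auto
  qed
  then have "inner (g - g') (g - g') = 0"
    by (simp add: inner_diff_left)
  then show ?thesis by simp
qed

lemma grad_eqI:
  assumes "(\<phi> has_derivative (\<lambda>v. inner g v)) (at x within euclid d)" "x \<in> euclid d" "g \<in> euclid d"
  shows "grad d \<phi> x = g"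
  unfolding grad_def
proof (rule the_equality)
  fix g' assume "g' \<in> euclid d \<and> (\<phi> has_derivative (\<lambda>v. inner g' v)) (at x within euclid d)"
  then show "g' = g"
    using gradient_unique[of \<phi> g' x d g] assms by simp
qed (use assms in simp)

lemma evec_euclid_expansion:
  assumes "x \<in> euclid d"
  shows "x = (\<Sum>k<d. coord x k *\<^sub>R unit_evec k)"
proof (rule evec_eqI)
  fix i
  have "(\<Sum>k<d. coord x k * (if i = k then 1 else 0)) = (if i < d then coord x i else 0)"
    by (simp add: if_distrib cong: if_cong)
  then show "coord x i = coord (\<Sum>k<d. coord x k *\<^sub>R unit_evec k) i"
    using assms by (auto simp: coord_sum scaleR_evec.rep_eq unit_evec.rep_eq euclid_def not_less)
qed

text \<open>Riesz representation in coordinates. The derivative within \<open>euclid d\<close> is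
  not determined on directions leaving the subspace, so \<open>D\<close> and \<open>inner g\<close>
  are compared only on \<open>euclid d\<close>, where all difference quotients lie.\<close>

lemma gradient_exists:
  assumes "\<phi> differentiable_on euclid d" "x \<in> euclid d"
  obtains g where "g \<in> euclid d" "(\<phi> has_derivative (\<lambda>v. inner g v)) (at x within euclid d)"
proof -
  obtain D where D: "(\<phi> has_derivative D) (at x within euclid d)"
    using assms by (auto simp: differentiable_on_def differentiable_def)
  then interpret bounded_linear D
    by (rule has_derivative_bounded_linear)
  define g where "g = (\<Sum>k<d. D (unit_evec k) *\<^sub>R unit_evec k)"
  have "unit_evec k \<in> euclid d" if "k < d" for k
    using that by (auto simp: euclid_def unit_evec.rep_eq)
  then have g: "g \<in> euclid d"
    unfolding g_def using subspace_euclid[of d] by (intro subspace_sum subspace_scale) auto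
  have eq: "D v = inner g v" if "v \<in> euclid d" for v
    by (subst evec_euclid_expansion[OF that])
      (simp add: sum scaleR g_def inner_sum_left inner_unit_evec mult.commute)
  have "(\<phi> has_derivative (\<lambda>v. inner g v)) (at x within euclid d)"
    unfolding has_derivative_within
  proof (intro conjI bounded_linear_inner_right)
    have "((\<lambda>y. (1 / norm (y - x)) *\<^sub>R (\<phi> y - (\<phi> x + D (y - x)))) \<longlongrightarrow> 0) (at x within euclid d)"
      using D unfolding has_derivative_within by blast
    moreover have "\<forall>\<^sub>F y in at x within euclid d. (1 / norm (y - x)) *\<^sub>R (\<phi> y - (\<phi> x + D (y - x)))
        = (1 / norm (y - x)) *\<^sub>R (\<phi> y - (\<phi> x + inner g (y - x)))"
      unfolding eventually_at_filter using eq assms(2) subspace_diff[OF subspace_euclid]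
      by (intro always_eventually) auto
    ultimately show "((\<lambda>y. (1 / norm (y - x)) *\<^sub>R (\<phi> y - (\<phi> x + inner g (y - x)))) \<longlongrightarrow> 0)
        (at x within euclid d)"
      by (rule Lim_transform_eventually)
  qed
  with g show thesis by (rule that)
qed

lemma
  assumes "\<phi> differentiable_on euclid d" "x \<in> euclid d"
  shows grad_in_euclid: "grad d \<phi> x \<in> euclid d"
    and has_derivative_grad: "(\<phi> has_derivative (\<lambda>v. inner (grad d \<phi> x) v)) (at x within euclid d)"
proof -
  obtain g where g: "g \<in> euclid d" "(\<phi> has_derivative (\<lambda>v. inner g v)) (at x within euclid d)"
    using gradient_exists[OF assms] .
  moreover have "grad d \<phi> x = g"
    by (rule grad_eqI) (use g assms in auto)
  ultimately show "grad d \<phi> x \<in> euclid d"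
    "(\<phi> has_derivative (\<lambda>v. inner (grad d \<phi> x) v)) (at x within euclid d)" by simp_all
qed

lemma grad_favg:
  assumes "\<And>i. i \<in> {1..n} \<Longrightarrow> f i differentiable_on euclid d" "x \<in> euclid d"
  shows "grad d (favg n f) x = (1 / real n) *\<^sub>R (\<Sum>i=1..n. grad d (f i) x)"
proof (rule grad_eqI)
  have "((\<lambda>x. (1 / real n) * (\<Sum>i=1..n. f i x)) has_derivative
      (\<lambda>v. (1 / real n) * (\<Sum>i=1..n. inner (grad d (f i) x) v))) (at x within euclid d)"
    by (intro has_derivative_mult_right has_derivative_sum has_derivative_grad assms)
  then show "(favg n f has_derivative (\<lambda>v. inner ((1 / real n) *\<^sub>R (\<Sum>i=1..n. grad d (f i) x)) v))
      (at x within euclid d)"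
    by (simp add: favg_def[abs_def] inner_sum_left)
  show "(1 / real n) *\<^sub>R (\<Sum>i=1..n. grad d (f i) x) \<in> euclid d"
    using subspace_euclid[of d] assms by (intro subspace_scale subspace_sum grad_in_euclid) auto
qed fact


section \<open>Smooth convex functions\<close>

lemma convex_above_gradient:
  assumes "convex_on (euclid d) \<phi>" "\<phi> differentiable_on euclid d" "x \<in> euclid d" "y \<in> euclid d"
  shows "\<phi> y \<ge> \<phi> x + inner (grad d \<phi> x) (y - x)"
proof -
  define v where "v = y - x"
  have v: "v \<in> euclid d"
    using assms subspace_diff[OF subspace_euclid] by (simp add: v_def)
  have line: "x + s *\<^sub>R v \<in> euclid d" for s
    using assms v subspace_euclid[of d] by (auto intro: subspace_add subspace_scale)
  have "convex_on UNIV (\<lambda>s::real. \<phi> (x + s *\<^sub>R v))"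
  proof (rule convex_onI)
    fix t s r :: real assume "0 < t" "t < 1"
    have "x + ((1 - t) *\<^sub>R s + t *\<^sub>R r) *\<^sub>R v = (1 - t) *\<^sub>R (x + s *\<^sub>R v) + t *\<^sub>R (x + r *\<^sub>R v)"
      by (simp add: algebra_simps)
    then show "\<phi> (x + ((1 - t) *\<^sub>R s + t *\<^sub>R r) *\<^sub>R v)
        \<le> (1 - t) * \<phi> (x + s *\<^sub>R v) + t * \<phi> (x + r *\<^sub>R v)"
      using convex_onD[OF assms(1), of t "x + s *\<^sub>R v" "x + r *\<^sub>R v"] \<open>0 < t\<close> \<open>t < 1\<close> line by simp
  qed simp
  moreover have "((\<lambda>s. \<phi> (x + s *\<^sub>R v)) has_real_derivative inner (grad d \<phi> x) v) (at 0)"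
    using has_derivative_grad[OF assms(2,3)] assms(3) v by (intro has_real_derivative_line) auto
  ultimately have "\<phi> (x + 1 *\<^sub>R v) - \<phi> (x + 0 *\<^sub>R v) \<ge> inner (grad d \<phi> x) v * (1 - 0)"
    by (intro convex_on_imp_above_tangent) auto
  then show ?thesis
    by (simp add: v_def)
qed

lemma smooth_descent:
  assumes "beta_smooth d \<beta> \<phi>" "x \<in> euclid d" "y \<in> euclid d"
  shows "\<phi> y \<le> \<phi> x + inner (grad d \<phi> x) (y - x) + \<beta> / 2 * (norm (y - x))\<^sup>2"
proof -
  define v where "v = y - x"
  \<comment> \<open>\<open>q\<close> is \<open>\<phi>\<close> along the segment minus its quadratic
    upper model, up to the constant \<open>\<phi> x\<close>. The Lipschitz bound makes its
    derivative nonpositive, and the claim is \<open>q 1 \<le> q 0\<close>.\<close>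
  define q where "q s = \<phi> (x + s *\<^sub>R v) - s * inner (grad d \<phi> x) v - \<beta> / 2 * s\<^sup>2 * (norm v)\<^sup>2" for s
  have v: "v \<in> euclid d"
    using assms subspace_diff[OF subspace_euclid] by (simp add: v_def)
  have line: "x + s *\<^sub>R v \<in> euclid d" for s
    using assms v subspace_euclid[of d] by (auto intro: subspace_add subspace_scale)
  have diff: "\<phi> differentiable_on euclid d"
    using assms by (simp add: beta_smooth_def)
  have "\<exists>q'. (q has_real_derivative q') (at s) \<and> q' \<le> 0" if "0 \<le> s" for s
  proof (intro exI conjI)
    let ?q' = "inner (grad d \<phi> (x + s *\<^sub>R v)) v - inner (grad d \<phi> x) v - \<beta> * s * (norm v)\<^sup>2"
    have "((\<lambda>s. \<phi> (x + s *\<^sub>R v)) has_real_derivative inner (grad d \<phi> (x + s *\<^sub>R v)) v) (at s)"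
      using has_derivative_grad[OF diff line] assms(2) v by (intro has_real_derivative_line) auto
    then show "(q has_real_derivative ?q') (at s)"
      unfolding q_def by (auto intro!: derivative_eq_intros)
    have "inner (grad d \<phi> (x + s *\<^sub>R v) - grad d \<phi> x) v
        \<le> norm (grad d \<phi> (x + s *\<^sub>R v) - grad d \<phi> x) * norm v"
      by (rule norm_cauchy_schwarz)
    also have "\<dots> \<le> (\<beta> * norm (x + s *\<^sub>R v - x)) * norm v"
      using assms(1,2) line unfolding beta_smooth_def
      by (intro mult_right_mono) (blast, simp)
    finally show "?q' \<le> 0"
      using that by (simp add: inner_diff_left power2_eq_square mult.assoc)
  qed
  then have "q 1 \<le> q 0"
    by (intro DERIV_nonpos_imp_nonincreasing[of 0 1 q]) auto
  then show ?thesis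
    by (simp add: q_def v_def)
qed

text \<open>Compares the two bounds at the minimizer of the quadratic upper model of
  \<open>\<phi> - \<langle>\<nabla>\<phi>(x), \<cdot>\<rangle>\<close> around \<open>y\<close>.\<close>

lemma smooth_convex_lower_bound:
  assumes "convex_on (euclid d) \<phi>" "beta_smooth d \<beta> \<phi>" "\<beta> > 0" "x \<in> euclid d" "y \<in> euclid d"
  shows "\<phi> y \<ge> \<phi> x + inner (grad d \<phi> x) (y - x) + (norm (grad d \<phi> x - grad d \<phi> y))\<^sup>2 / (2 * \<beta>)"
proof -
  define e where "e = grad d \<phi> y - grad d \<phi> x"
  define w where "w = y - (1 / \<beta>) *\<^sub>R e"
  have diff: "\<phi> differentiable_on euclid d"
    using assms by (simp add: beta_smooth_def)
  have w: "w \<in> euclid d"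
    unfolding w_def e_def using assms diff subspace_euclid[of d]
    by (intro subspace_diff subspace_scale grad_in_euclid) auto
  have low: "\<phi> w \<ge> \<phi> x + inner (grad d \<phi> x) (w - x)"
    by (rule convex_above_gradient) (use assms diff w in auto)
  have up: "\<phi> w \<le> \<phi> y + inner (grad d \<phi> y) (w - y) + \<beta> / 2 * (norm (w - y))\<^sup>2"
    by (rule smooth_descent) (use assms w in auto)
  have 1: "inner (grad d \<phi> x) (w - x) = inner (grad d \<phi> x) (y - x) - inner (grad d \<phi> x) e / \<beta>"
    by (simp add: w_def algebra_simps inner_diff_right)
  have 2: "inner (grad d \<phi> y) (w - y) = - inner (grad d \<phi> y) e / \<beta>"
    by (simp add: w_def)
  have 3: "\<beta> / 2 * (norm (w - y))\<^sup>2 = (norm e)\<^sup>2 / (2 * \<beta>)"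
    using \<open>\<beta> > 0\<close> by (simp add: w_def power_mult_distrib power_divide field_simps power2_eq_square)
  have 4: "inner (grad d \<phi> y) e / \<beta> - inner (grad d \<phi> x) e / \<beta> = 2 * ((norm e)\<^sup>2 / (2 * \<beta>))"
    using \<open>\<beta> > 0\<close> by (simp add: e_def power2_norm_eq_inner inner_diff_left diff_divide_distrib)
  have "norm (grad d \<phi> x - grad d \<phi> y) = norm e"
    by (simp add: e_def norm_minus_commute)
  with low up 1 2 3 4 show ?thesis by simp
qed


section \<open>Means and expectations\<close>

text \<open>Bias-variance decomposition: the cross terms cancel because deviations from the mean sum
  to 0.\<close>

lemma sum_norm_diff_squared:
  fixes G :: "'i \<Rightarrow> 'a::real_inner"
  assumes "(\<Sum>i\<in>I. G i) = real (card I) *\<^sub>R m"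
  shows "(\<Sum>i\<in>I. (norm (G i - p))\<^sup>2) = (\<Sum>i\<in>I. (norm (G i - m))\<^sup>2) + real (card I) * (norm (m - p))\<^sup>2"
proof -
  have "(norm (G i - p))\<^sup>2 = (norm (G i - m))\<^sup>2 + 2 * inner (G i - m) (m - p) + (norm (m - p))\<^sup>2" for i
    by (simp add: power2_norm_eq_inner algebra_simps inner_diff_left inner_diff_right inner_commute)
  then have "(\<Sum>i\<in>I. (norm (G i - p))\<^sup>2) = (\<Sum>i\<in>I. (norm (G i - m))\<^sup>2)
      + 2 * inner (\<Sum>i\<in>I. G i - m) (m - p) + real (card I) * (norm (m - p))\<^sup>2"
    by (simp add: sum.distrib inner_sum_left sum_distrib_left)
  also have "(\<Sum>i\<in>I. G i - m) = 0"
    using assms by (simp add: sum_subtractf sum_constant_scaleR)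
  finally show ?thesis by simp
qed

text \<open>Tower property for a bound on conditional expectations. Finite supports turn all
  integrals into finite sums.\<close>

lemma expectation_bind_le:
  fixes \<phi> :: "'b \<Rightarrow> real"
  assumes "finite (set_pmf p)" "\<And>x. x \<in> set_pmf p \<Longrightarrow> finite (set_pmf (q x))"
    and "\<And>x. x \<in> set_pmf p \<Longrightarrow> measure_pmf.expectation (q x) \<phi> \<le> \<psi> x"
  shows "measure_pmf.expectation (bind_pmf p q) \<phi> \<le> measure_pmf.expectation p \<psi>"
proof -
  have "measure_pmf.expectation (bind_pmf p q) \<phi>
      = (\<Sum>x\<in>set_pmf p. pmf p x *\<^sub>R measure_pmf.expectation (q x) \<phi>)"
    by (rule pmf_expectation_bind) (use assms in auto)
  also have "\<dots> \<le> (\<Sum>x\<in>set_pmf p. pmf p x *\<^sub>R \<psi> x)"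
    using assms by (intro sum_mono) (auto intro: mult_left_mono)
  also have "\<dots> = measure_pmf.expectation p \<psi>"
    using assms by (subst integral_measure_pmf[of "set_pmf p"]) (auto simp: set_pmf_iff)
  finally show ?thesis .
qed


section \<open>One step of the algorithm\<close>

lemma norm_scaleR_add_squared:
  fixes x y :: "'a::real_inner"
  shows "(norm (s *\<^sub>R x + y))\<^sup>2 = s\<^sup>2 * (norm x)\<^sup>2 + 2 * s * inner x y + (norm y)\<^sup>2"
  unfolding power2_norm_eq_inner
  by (simp add: inner_add_left inner_add_right inner_commute[of y x] algebra_simps power2_eq_square)

text \<open>Parallelogram law for \<open>x - c\<close> and \<open>y - c\<close>, with one square
  dropped.\<close>

lemma norm_diff_squared_le:
  fixes x y c :: "'a::real_inner"
  shows "(norm (x - y))\<^sup>2 \<le> 2 * (norm (x - c))\<^sup>2 + 2 * (norm (y - c))\<^sup>2"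
proof -
  have "(norm (x - y))\<^sup>2 + (norm ((y - c) + (x - c)))\<^sup>2 = 2 * (norm (x - c))\<^sup>2 + 2 * (norm (y - c))\<^sup>2"
    using norm_scaleR_add_squared[of 1 "y - c" "x - c"] norm_scaleR_add_squared[of "-1" "y - c" "x - c"]
    by (simp add: algebra_simps)
  then show ?thesis
    using zero_le_power2[of "norm ((y - c) + (x - c))"] by linarith
qed

lemma convex_on_three:
  fixes x y z :: "'a::real_vector"
  assumes "convex_on X \<phi>" "x \<in> X" "y \<in> X" "z \<in> X" "p \<ge> 0" "q \<ge> 0" "r \<ge> 0" "p + q + r > 0"
  defines "w \<equiv> (1 / (p + q + r)) *\<^sub>R (p *\<^sub>R x + q *\<^sub>R y + r *\<^sub>R z)"
  shows "w \<in> X" and "(p + q + r) * \<phi> w \<le> p * \<phi> x + q * \<phi> y + r * \<phi> z"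
proof -
  define s where "s = p + q + r"
  have s: "s > 0" using assms by (simp add: s_def)
  let ?a = "\<lambda>i::nat. (if i = 0 then p else if i = 1 then q else r) / s"
  let ?y = "\<lambda>i::nat. if i = 0 then x else if i = 1 then y else z"
  have sum: "sum ?a {0, 1, 2} = 1"
    using s by (simp add: add_divide_distrib[symmetric]) (simp add: s_def)
  have w: "w = (\<Sum>i\<in>{0, 1, 2}. ?a i *\<^sub>R ?y i)"
    by (simp add: w_def s_def[symmetric] scaleR_add_right)
  have X: "convex X"
    using assms convex_on_imp_convex by blast
  show "w \<in> X"
    unfolding w using assms s sum X by (intro convex_sum) auto
  have "\<phi> w \<le> (\<Sum>i\<in>{0, 1, 2}. ?a i * \<phi> (?y i))"
    unfolding w using assms s sum by (intro convex_on_sum) auto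
  also have "\<dots> = (p * \<phi> x + q * \<phi> y + r * \<phi> z) / s"
    by (simp add: add_divide_distrib)
  finally show "(p + q + r) * \<phi> w \<le> p * \<phi> x + q * \<phi> y + r * \<phi> z"
    unfolding s_def[symmetric] using s by (simp add: field_simps)
qed

text \<open>Optimality condition without subgradients: compare \<open>p\<close> with the point
  \<open>(1 - t) p + t w\<close>, divide by \<open>t\<close>, and let \<open>t\<close> tend to 0
  from the right.\<close>

lemma prox_three_point:
  fixes p w z :: "'a::real_inner"
  assumes "convex_on X l" "p \<in> X" "w \<in> X"
    and min: "\<And>y. y \<in> X \<Longrightarrow> l p + c * (norm (p - z))\<^sup>2 \<le> l y + c * (norm (y - z))\<^sup>2"
  shows "l p + c * (norm (p - z))\<^sup>2 + c * (norm (w - p))\<^sup>2 \<le> l w + c * (norm (w - z))\<^sup>2"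
proof -
  \<comment> \<open>\<open>K\<close> bounds from above the slope at \<open>p\<close> towards
    \<open>w\<close> of the minimized function; convexity supplies the bound
    \<open>l w - l p\<close> for the part \<open>l\<close>.\<close>
  define K where "K = l w - l p + 2 * c * inner (p - z) (w - p)"
  have K: "0 \<le> K + t * (c * (norm (w - p))\<^sup>2)" if t: "0 < t" "t < 1" for t
  proof -
    let ?y = "(1 - t) *\<^sub>R p + t *\<^sub>R w"
    have "?y \<in> X"
      using assms(2,3) t convex_on_imp_convex[OF assms(1)] by (intro convexD) auto
    then have "l p + c * (norm (p - z))\<^sup>2 \<le> l ?y + c * (norm (?y - z))\<^sup>2"
      by (rule min)
    also have "l ?y \<le> (1 - t) * l p + t * l w"
      using convex_onD[OF assms(1), of t p w] assms t by simp
    also have "?y - z = t *\<^sub>R (w - p) + (p - z)"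
      by (simp add: algebra_simps)
    also note norm_scaleR_add_squared
    finally have "0 \<le> t * (K + t * (c * (norm (w - p))\<^sup>2))"
      unfolding K_def inner_commute[of "p - z"] by (simp add: algebra_simps power2_eq_square)
    with t show ?thesis
      by (simp add: zero_le_mult_iff)
  qed
  have "((\<lambda>t. K + t * (c * (norm (w - p))\<^sup>2)) \<longlongrightarrow> K + 0 * (c * (norm (w - p))\<^sup>2)) (at_right 0)"
    by (intro tendsto_intros)
  then have "0 \<le> K + 0 * (c * (norm (w - p))\<^sup>2)"
    by (rule tendsto_lowerbound)
      (use K in \<open>auto simp: eventually_at_right_field intro!: exI[of _ 1]\<close>)
  moreover have "(norm (w - z))\<^sup>2 = (norm (p - z))\<^sup>2 + 2 * inner (p - z) (w - p) + (norm (w - p))\<^sup>2"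
    using norm_scaleR_add_squared[of 1 "p - z" "w - p"] by simp
  ultimately show ?thesis
    unfolding K_def by (simp add: distrib_left)
qed

section \<open>The finite-sum problem and distances between gradients\<close>

locale vrae_problem =
  fixes d n :: nat and X :: "evec set" and f :: "nat \<Rightarrow> evec \<Rightarrow> real" and h :: "evec \<Rightarrow> real"
    and \<beta> :: real and xstar :: evec
  assumes problem: "problem d n X f h \<beta>"
    and minimizer: "is_arg_min (objective n f h) (\<lambda>x. x \<in> X) xstar"
begin

abbreviation full_grad :: "evec \<Rightarrow> evec" where
  "full_grad \<equiv> grad d (favg n f)"

definition gap :: "evec \<Rightarrow> real" where
  "gap x = objective n f h x - objective n f h xstar"

text \<open>The common measure of gains and errors: smoothness gains multiples of it, and it bounds
  both the change of the full gradient and the variance of the estimator.\<close>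

definition grad_dist :: "evec \<Rightarrow> evec \<Rightarrow> real" where
  "grad_dist x y = (\<Sum>i=1..n. (norm (grad d (f i) x - grad d (f i) y))\<^sup>2) / real n"

lemma n_pos: "n \<ge> 1" and beta_pos: "\<beta> > 0" and X_euclid: "x \<in> X \<Longrightarrow> x \<in> euclid d"
  and X_convex: "convex X" and h_convex: "convex_on X h"
  using problem by (auto simp: problem_def)

lemma f_convex: "i \<in> {1..n} \<Longrightarrow> convex_on (euclid d) (f i)"
  and f_smooth: "i \<in> {1..n} \<Longrightarrow> beta_smooth d \<beta> (f i)"
  using problem by (auto simp: problem_def)

lemma f_differentiable: "i \<in> {1..n} \<Longrightarrow> f i differentiable_on euclid d"
  using f_smooth by (simp add: beta_smooth_def)

lemma xstar_in: "xstar \<in> X"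
  using minimizer by (simp add: is_arg_min_def)

lemma gap_nonneg: "x \<in> X \<Longrightarrow> gap x \<ge> 0"
  using minimizer by (force simp: gap_def is_arg_min_def not_less)

lemma full_grad_eq:
  "x \<in> euclid d \<Longrightarrow> full_grad x = (1 / real n) *\<^sub>R (\<Sum>i=1..n. grad d (f i) x)"
  by (rule grad_favg) (auto intro: f_differentiable)

lemma full_grad: "x \<in> euclid d \<Longrightarrow> real n *\<^sub>R full_grad x = (\<Sum>i=1..n. grad d (f i) x)"
  using n_pos by (simp add: full_grad_eq)

lemma component_grad_in: "i \<in> {1..n} \<Longrightarrow> x \<in> euclid d \<Longrightarrow> grad d (f i) x \<in> euclid d"
  by (rule grad_in_euclid[OF f_differentiable])

lemma full_grad_in: "x \<in> euclid d \<Longrightarrow> full_grad x \<in> euclid d"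
  unfolding full_grad_eq using subspace_euclid[of d]
  by (intro subspace_scale subspace_sum component_grad_in) auto

lemma grad_dist_nonneg: "grad_dist x y \<ge> 0"
  by (simp add: grad_dist_def sum_nonneg)

lemma norm_full_grad_diff:
  assumes "x \<in> euclid d" "y \<in> euclid d"
  shows "(norm (full_grad x - full_grad y))\<^sup>2 \<le> grad_dist x y"
proof -
  have "(\<Sum>i=1..n. grad d (f i) x - grad d (f i) y) = real (card {1..n}) *\<^sub>R (full_grad x - full_grad y)"
    using assms by (simp add: sum_subtractf full_grad scaleR_diff_right)
  \<comment> \<open>Jensen's inequality for the square: decompose around 0 and drop the
    deviations.\<close>
  from sum_norm_diff_squared[OF this, of 0]
  have "real n * (norm (full_grad x - full_grad y))\<^sup>2
      \<le> (\<Sum>i=1..n. (norm (grad d (f i) x - grad d (f i) y))\<^sup>2)"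
    by (simp add: sum_nonneg)
  then show ?thesis
    using n_pos by (simp add: grad_dist_def field_simps)
qed

lemma favg_lower_bound:
  assumes "x \<in> euclid d" "y \<in> euclid d"
  shows "favg n f y \<ge> favg n f x + inner (full_grad x) (y - x) + grad_dist x y / (2 * \<beta>)"
proof -
  have "(\<Sum>i=1..n. f i x + inner (grad d (f i) x) (y - x)
      + (norm (grad d (f i) x - grad d (f i) y))\<^sup>2 / (2 * \<beta>)) \<le> (\<Sum>i=1..n. f i y)"
    using assms f_convex f_smooth beta_pos by (intro sum_mono smooth_convex_lower_bound) auto
  also have "(\<Sum>i=1..n. f i x + inner (grad d (f i) x) (y - x)
      + (norm (grad d (f i) x - grad d (f i) y))\<^sup>2 / (2 * \<beta>))
      = (\<Sum>i=1..n. f i x) + inner (real n *\<^sub>R full_grad x) (y - x)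
        + (\<Sum>i=1..n. (norm (grad d (f i) x - grad d (f i) y))\<^sup>2) / (2 * \<beta>)"
    unfolding full_grad[OF assms(1)] by (simp add: sum.distrib inner_sum_left sum_divide_distrib)
  also have "\<dots> = real n * (favg n f x + inner (full_grad x) (y - x) + grad_dist x y / (2 * \<beta>))"
    using n_pos by (simp add: favg_def grad_dist_def field_simps)
  also have "(\<Sum>i=1..n. f i y) = real n * favg n f y"
    using n_pos by (simp add: favg_def)
  finally show ?thesis
    using n_pos by simp
qed

section \<open>Proximal steps and the coupling inequality\<close>

text \<open>Completing the square turns the objective into \<open>8 * \<beta>\<close> times the
  proximal objective with weight \<open>l\<close> and centre \<open>z - l *\<^sub>R g\<close>, plus
  the constant \<open>c\<close>. For that objective \<open>problem\<close> provides a
  minimizer.\<close>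

lemma prox_step_is_arg_min:
  assumes "a \<ge> 0" "g \<in> euclid d" "z \<in> euclid d"
  shows "is_arg_min (\<lambda>x. a * inner g x + a * h x + 4 * \<beta> * (norm (x - z))\<^sup>2) (\<lambda>x. x \<in> X)
    (prox_step X h \<beta> a g z)"
proof -
  define l where "l = a / (8 * \<beta>)"
  define v where "v = z - l *\<^sub>R g"
  define c where "c = a * inner g z - 8 * \<beta> * (l\<^sup>2 / 2 * (norm g)\<^sup>2)"
  have l: "l \<ge> 0" and a: "a = 8 * \<beta> * l"
    using assms beta_pos by (auto simp: l_def)
  have "v \<in> euclid d"
    unfolding v_def using assms subspace_euclid[of d] by (intro subspace_diff subspace_scale)
  then obtain x where x: "is_arg_min (\<lambda>x. l * h x + 1 / 2 * (norm (x - v))\<^sup>2) (\<lambda>x. x \<in> X) x"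
    using problem l unfolding problem_def by blast
  have "a * inner g y + a * h y + 4 * \<beta> * (norm (y - z))\<^sup>2
      = 8 * \<beta> * (l * h y + 1 / 2 * (norm (y - v))\<^sup>2) + c" for y
  proof -
    have "y - v = l *\<^sub>R g + (y - z)"
      by (simp add: v_def)
    then have norm: "(norm (y - v))\<^sup>2 = l\<^sup>2 * (norm g)\<^sup>2 + 2 * l * inner g (y - z) + (norm (y - z))\<^sup>2"
      by (simp only: norm_scaleR_add_squared)
    show ?thesis
      unfolding norm c_def a by (simp add: algebra_simps inner_diff_right)
  qed
  with x beta_pos
  have "is_arg_min (\<lambda>x. a * inner g x + a * h x + 4 * \<beta> * (norm (x - z))\<^sup>2) (\<lambda>x. x \<in> X) x"
    by (simp add: is_arg_min_def)
  then show ?thesis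
    unfolding prox_step_def arg_min_on_def arg_min_def by (rule someI)
qed

lemma prox_step_in: "a \<ge> 0 \<Longrightarrow> g \<in> euclid d \<Longrightarrow> z \<in> euclid d \<Longrightarrow> prox_step X h \<beta> a g z \<in> X"
  using prox_step_is_arg_min by (simp add: is_arg_min_def)

lemma prox_step_optimal:
  assumes "a \<ge> 0" "g \<in> euclid d" "z \<in> euclid d" "w \<in> X"
  defines "p \<equiv> prox_step X h \<beta> a g z"
  shows "a * inner g p + a * h p + 4 * \<beta> * (norm (p - z))\<^sup>2 + 4 * \<beta> * (norm (w - p))\<^sup>2
    \<le> a * inner g w + a * h w + 4 * \<beta> * (norm (w - z))\<^sup>2"
proof (rule prox_three_point[where l = "\<lambda>x. a * inner g x + a * h x"])
  have "convex_on X (\<lambda>x. inner (a *\<^sub>R g) x)"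
    using X_convex by (intro convex_onI) (auto simp: inner_add_right)
  moreover have "convex_on X (\<lambda>x. a * h x)"
    using assms h_convex by (intro convex_on_cmul)
  ultimately show "convex_on X (\<lambda>x. a * inner g x + a * h x)"
    using convex_on_add by fastforce
  show "p \<in> X"
    using assms prox_step_in by simp
  show "a * inner g p + a * h p + 4 * \<beta> * (norm (p - z))\<^sup>2
      \<le> a * inner g y + a * h y + 4 * \<beta> * (norm (y - z))\<^sup>2" if "y \<in> X" for y
    using prox_step_is_arg_min[OF assms(1-3)] that by (auto simp: p_def is_arg_min_def not_less)
qed fact

text \<open>Add the three-point inequality of the second proximal step, tested at \<open>w\<close>,
  to that of the first, tested at \<open>z'\<close>. What remains is the product of
  \<open>g' - g\<close> with \<open>x - z'\<close>, which the squared distance from \<open>x\<close>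
  to \<open>z'\<close> absorbs.\<close>

lemma extragradient_step:
  assumes "a \<ge> 0" "g \<in> euclid d" "g' \<in> euclid d" "z \<in> euclid d" "w \<in> X"
  defines "x \<equiv> prox_step X h \<beta> a g z" and "z' \<equiv> prox_step X h \<beta> a g' z"
  shows "a * inner g' (x - w) + a * (h x - h w) + 4 * \<beta> * (norm (w - z'))\<^sup>2
    \<le> 4 * \<beta> * (norm (w - z))\<^sup>2 + a\<^sup>2 / (16 * \<beta>) * (norm (g' - g))\<^sup>2"
proof -
  have z': "z' \<in> X"
    using assms prox_step_in by simp
  have 1: "a * inner g' z' + a * h z' + 4 * \<beta> * (norm (z' - z))\<^sup>2 + 4 * \<beta> * (norm (w - z'))\<^sup>2
      \<le> a * inner g' w + a * h w + 4 * \<beta> * (norm (w - z))\<^sup>2"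
    unfolding z'_def by (rule prox_step_optimal) fact+
  have 2: "a * inner g x + a * h x + 4 * \<beta> * (norm (x - z))\<^sup>2 + 4 * \<beta> * (norm (z' - x))\<^sup>2
      \<le> a * inner g z' + a * h z' + 4 * \<beta> * (norm (z' - z))\<^sup>2"
    unfolding x_def by (rule prox_step_optimal) fact+
  \<comment> \<open>Young's inequality as a complete square. The weight
    \<open>a / (8 * \<beta>)\<close> normalizes the cross term, and its square times
    \<open>4 * \<beta>\<close> is the error coefficient
    \<open>a\<^sup>2 / (16 * \<beta>)\<close>.\<close>
  have "0 \<le> 4 * \<beta> * (norm ((a / (8 * \<beta>)) *\<^sub>R (g' - g) + (z' - x)))\<^sup>2"
    using beta_pos by simp
  also have "\<dots> = 4 * \<beta> * ((a / (8 * \<beta>))\<^sup>2 * (norm (g' - g))\<^sup>2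
      + 2 * (a / (8 * \<beta>)) * inner (g' - g) (z' - x) + (norm (z' - x))\<^sup>2)"
    by (simp only: norm_scaleR_add_squared)
  also have "\<dots> = a\<^sup>2 / (16 * \<beta>) * (norm (g' - g))\<^sup>2
      + a * inner (g' - g) (z' - x) + 4 * \<beta> * (norm (z' - x))\<^sup>2"
    using beta_pos by (simp add: field_simps power2_eq_square)
  finally have "0 \<le> a\<^sup>2 / (16 * \<beta>) * (norm (g' - g))\<^sup>2
      + a * inner (g' - g) (z' - x) + 4 * \<beta> * (norm (z' - x))\<^sup>2" .
  moreover have "4 * \<beta> * (norm (x - z))\<^sup>2 \<ge> 0"
    using beta_pos by simp
  ultimately show ?thesis
    using 1 2 by (simp add: inner_diff_left inner_diff_right algebra_simps)
qed

text \<open>Use the lower bound on \<open>favg n f\<close> at \<open>y'\<close> towards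
  \<open>y\<close>, \<open>u\<close> and \<open>xstar\<close> with weights \<open>A\<close>,
  \<open>a\<^sup>2\<close> and \<open>a\<close>. As \<open>y'\<close> is the average with the same
  weights, but with \<open>x\<close> in place of \<open>xstar\<close>, the linear terms collapse to
  the product with \<open>x - xstar\<close>. Jensen handles \<open>h\<close>.\<close>

lemma coupling:
  assumes "a > 0" "A \<ge> 0" "x \<in> X" "y \<in> X" "u \<in> X"
  defines "A' \<equiv> A + a + a\<^sup>2"
  defines "y' \<equiv> (1 / A') *\<^sub>R (A *\<^sub>R y + a *\<^sub>R x + a\<^sup>2 *\<^sub>R u)"
  shows "y' \<in> X"
    and "A' * gap y' + A / (2 * \<beta>) * grad_dist y' y + a\<^sup>2 / (2 * \<beta>) * grad_dist y' u
      \<le> A * gap y + a\<^sup>2 * gap u + a * inner (full_grad y') (x - xstar) + a * (h x - h xstar)"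
proof -
  have A': "A + a + a\<^sup>2 > 0"
    using assms by (simp add: add_nonneg_pos add_pos_nonneg)
  show y'_in: "y' \<in> X"
    unfolding y'_def A'_def by (rule convex_on_three(1)[OF h_convex]) (use assms A' in auto)
  have h: "A' * h y' \<le> A * h y + a * h x + a\<^sup>2 * h u"
    unfolding y'_def A'_def by (rule convex_on_three(2)[OF h_convex]) (use assms A' in auto)
  have low: "favg n f y' + inner (full_grad y') (w - y') + grad_dist y' w / (2 * \<beta>) \<le> favg n f w"
    if "w \<in> X" for w
    using favg_lower_bound y'_in that X_euclid by blast
  have 1: "A * (favg n f y' + inner (full_grad y') (y - y') + grad_dist y' y / (2 * \<beta>)) \<le> A * favg n f y"
    using low assms by (intro mult_left_mono) auto
  have 2: "a\<^sup>2 * (favg n f y' + inner (full_grad y') (u - y') + grad_dist y' u / (2 * \<beta>)) \<le> a\<^sup>2 * favg n f u"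
    using low assms by (intro mult_left_mono) auto
  have "favg n f y' + inner (full_grad y') (xstar - y') \<le> favg n f xstar"
    using low[OF xstar_in] grad_dist_nonneg[of y' xstar] beta_pos
    by (smt (verit) divide_nonneg_pos)
  then have 3: "a * (favg n f y' + inner (full_grad y') (xstar - y')) \<le> a * favg n f xstar"
    using assms by (intro mult_left_mono) auto
  have "A' *\<^sub>R y' = A *\<^sub>R y + a *\<^sub>R x + a\<^sup>2 *\<^sub>R u"
    using A' by (simp add: y'_def A'_def)
  then have "A' * inner (full_grad y') y' = inner (full_grad y') (A *\<^sub>R y + a *\<^sub>R x + a\<^sup>2 *\<^sub>R u)"
    by (metis inner_scaleR_right)
  then have 4: "A * inner (full_grad y') (y - y') + a\<^sup>2 * inner (full_grad y') (u - y')
      + a * inner (full_grad y') (xstar - y') = - (a * inner (full_grad y') (x - xstar))"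
    by (simp add: A'_def inner_diff_right inner_add_right algebra_simps)
  show "A' * gap y' + A / (2 * \<beta>) * grad_dist y' y + a\<^sup>2 / (2 * \<beta>) * grad_dist y' u
      \<le> A * gap y + a\<^sup>2 * gap u + a * inner (full_grad y') (x - xstar) + a * (h x - h xstar)"
    using h 1 2 3 4 unfolding gap_def objective_def A'_def distrib_left distrib_right right_diff_distrib
    by simp
qed

section \<open>The Lyapunov function and the variance-reduced estimator\<close>

definition feasible :: "vrae_state \<Rightarrow> bool" where
  "feasible st \<longleftrightarrow> xbar st \<in> X \<and> zpt st \<in> X \<and> gvec st \<in> euclid d"

definition potential :: "vrae_state \<Rightarrow> real" where
  "potential st = Acoef st * gap (xbar st) + 4 * \<beta> * (norm (xstar - zpt st))\<^sup>2"

text \<open>The gradient error has twice the extragradient coefficient, since splitting the squared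
  change of the estimate at the previous full gradient doubles both parts.\<close>

definition lyapunov :: "real \<Rightarrow> vrae_state \<Rightarrow> real" where
  "lyapunov a st = potential st + a\<^sup>2 / (8 * \<beta>) * (norm (gvec st - full_grad (xbar st)))\<^sup>2"

definition next_xbar :: "real \<Rightarrow> evec \<Rightarrow> vrae_state \<Rightarrow> evec" where
  "next_xbar a u st = (1 / (Acoef st + a + a\<^sup>2)) *\<^sub>R
     (Acoef st *\<^sub>R xbar st + a *\<^sub>R prox_step X h \<beta> a (gvec st) (zpt st) + a\<^sup>2 *\<^sub>R u)"

definition next_state :: "real \<Rightarrow> evec \<Rightarrow> nat \<Rightarrow> vrae_state \<Rightarrow> evec \<Rightarrow> vrae_state" where
  "next_state a u k st g = \<lparr>xbar = next_xbar a u st, zpt = prox_step X h \<beta> a g (zpt st), gvec = g,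
     Acoef = Acoef st + a + a\<^sup>2, ngrads = ngrads st + k\<rparr>"

text \<open>In the exact case the index is ignored, so that the last step of an epoch is also a map
  of a uniform draw and both kinds of step share one analysis.\<close>

definition estimator :: "bool \<Rightarrow> evec \<Rightarrow> evec \<Rightarrow> nat \<Rightarrow> evec" where
  "estimator exact u x i =
     (if exact then full_grad x else grad d (f i) x - grad d (f i) u + full_grad u)"

lemma vrae_step_eq:
  "vrae_step d n X f h \<beta> a T u t st =
     map_pmf (\<lambda>i. next_state a u (if t = T then n else 2) st (estimator (t = T) u (next_xbar a u st) i))
       (pmf_of_set {1..n})"
  by (simp add: vrae_step_def Let_def next_state_def next_xbar_def estimator_def)

lemma finite_vrae_step: "finite (set_pmf (vrae_step d n X f h \<beta> a T u t st))"
  using n_pos by (simp add: vrae_step_eq set_pmf_of_set)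

lemma estimator_in:
  assumes "i \<in> {1..n}" "x \<in> euclid d" "u \<in> euclid d"
  shows "estimator b u x i \<in> euclid d"
proof (cases b)
  case True
  then show ?thesis
    using assms full_grad_in by (simp add: estimator_def)
next
  case False
  have "grad d (f i) x - grad d (f i) u + full_grad u \<in> euclid d"
    by (intro subspace_add[OF subspace_euclid] subspace_diff[OF subspace_euclid]
        full_grad_in component_grad_in assms)
  then show ?thesis
    using False by (simp add: estimator_def)
qed

lemma estimator_mean:
  assumes "x \<in> euclid d" "u \<in> euclid d"
  shows "(\<Sum>i=1..n. estimator b u x i) = real n *\<^sub>R full_grad x"
proof (cases b)
  case False
  have "(\<Sum>i=1..n. full_grad u) = real n *\<^sub>R full_grad u"
    by (simp add: sum_constant_scaleR)
  then show ?thesis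
    using False assms by (simp add: estimator_def sum.distrib sum_subtractf full_grad)
qed (simp add: estimator_def sum_constant_scaleR)

text \<open>The second moment about the mean is at most that about \<open>full_grad u\<close>, and
  the latter deviations are differences of component gradients. In the exact case the left side is
  0.\<close>

lemma estimator_variance:
  assumes "x \<in> euclid d" "u \<in> euclid d"
  shows "(\<Sum>i=1..n. (norm (estimator b u x i - full_grad x))\<^sup>2) \<le> real n * grad_dist x u"
proof (cases b)
  case True
  then show ?thesis
    by (simp add: estimator_def grad_dist_nonneg)
next
  case False
  have "(\<Sum>i=1..n. estimator b u x i) = real (card {1..n}) *\<^sub>R full_grad x"
    using estimator_mean[OF assms] by simp
  from sum_norm_diff_squared[OF this, of "full_grad u"]
  have "(\<Sum>i=1..n. (norm (estimator b u x i - full_grad x))\<^sup>2)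
      \<le> (\<Sum>i=1..n. (norm (estimator b u x i - full_grad u))\<^sup>2)"
    by simp
  then show ?thesis
    using False n_pos by (simp add: estimator_def grad_dist_def)
qed

lemma next_xbar_in:
  assumes "feasible st" "u \<in> X" "a > 0" "Acoef st \<ge> 0"
  shows "next_xbar a u st \<in> X"
proof -
  have st: "xbar st \<in> X" "zpt st \<in> X" "gvec st \<in> euclid d"
    using assms(1) by (auto simp: feasible_def)
  then have "prox_step X h \<beta> a (gvec st) (zpt st) \<in> X"
    using \<open>a > 0\<close> X_euclid by (intro prox_step_in) simp_all
  from coupling(1)[OF \<open>a > 0\<close> \<open>Acoef st \<ge> 0\<close> this st(1) \<open>u \<in> X\<close>] show ?thesis
    unfolding next_xbar_def .
qed

text \<open>Bookkeeping in units of \<open>W\<close>. The variance costs one unit from the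
  extragradient error and two from the new Lyapunov term, against eight gained from the anchor. The
  change of the full gradient costs two units of \<open>grad_dist y (xbar st)\<close>, which
  \<open>coupling\<close> pays for; the old gradient error costs two, exactly its share in
  \<open>lyapunov a st\<close>.\<close>

lemma lyapunov_step_average:
  assumes "feasible st" "u \<in> X" "a > 0" "a\<^sup>2 \<le> 4 * Acoef st"
  shows "(\<Sum>i=1..n. lyapunov a (next_state a u k st (estimator b u (next_xbar a u st) i)))
    \<le> real n * (lyapunov a st + a\<^sup>2 * gap u)"
proof -
  define y where "y = next_xbar a u st"
  define x where "x = prox_step X h \<beta> a (gvec st) (zpt st)"
  define A where "A = Acoef st"
  define G where "G = estimator b u y"
  define m where "m = full_grad y"
  define W where "W = a\<^sup>2 / (16 * \<beta>)"
  define S1 where "S1 = (\<Sum>i=1..n. 4 * \<beta> * (norm (xstar - prox_step X h \<beta> a (G i) (zpt st)))\<^sup>2)"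
  define S2 where "S2 = (\<Sum>i=1..n. (norm (G i - m))\<^sup>2)"
  define N where "N = (norm (m - gvec st))\<^sup>2"
  define M where "M = (norm (gvec st - full_grad (xbar st)))\<^sup>2"
  define Z where "Z = 4 * \<beta> * (norm (xstar - zpt st))\<^sup>2"
  define P where "P = a * inner m (x - xstar) + a * (h x - h xstar)"
  have st: "xbar st \<in> X" "zpt st \<in> X" "gvec st \<in> euclid d"
    using assms by (auto simp: feasible_def)
  have A: "A \<ge> 0" "a\<^sup>2 \<le> 4 * A"
    using assms(4) zero_le_power2[of a] unfolding A_def by linarith+
  have y: "y \<in> X"
    unfolding y_def using assms A by (intro next_xbar_in) (auto simp: A_def)
  note euclid = X_euclid[OF y] X_euclid[OF \<open>u \<in> X\<close>] X_euclid[OF st(1)] X_euclid[OF st(2)] st(3)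
  have x: "x \<in> X"
    unfolding x_def using \<open>a > 0\<close> euclid by (intro prox_step_in) simp_all
  have G: "G i \<in> euclid d" if "i \<in> {1..n}" for i
    unfolding G_def using that euclid by (intro estimator_in)
  have mean: "(\<Sum>i=1..n. G i) = real n *\<^sub>R m"
    unfolding G_def m_def using euclid by (intro estimator_mean)
  \<comment> \<open>The last fact is the hypothesis \<open>a\<^sup>2 \<le> 4 * Acoef st\<close>
    rescaled.\<close>
  have W: "W \<ge> 0" "a\<^sup>2 / (8 * \<beta>) = 2 * W" "a\<^sup>2 / (2 * \<beta>) = 8 * W" "2 * W \<le> A / (2 * \<beta>)"
    using beta_pos A by (auto simp: W_def field_simps)

  have "(\<Sum>i=1..n. a * inner (G i) (x - xstar) + a * (h x - h xstar)
        + 4 * \<beta> * (norm (xstar - prox_step X h \<beta> a (G i) (zpt st)))\<^sup>2)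
      \<le> (\<Sum>i=1..n. Z + W * (norm (G i - gvec st))\<^sup>2)"
    unfolding Z_def W_def x_def
    using \<open>a > 0\<close> euclid G xstar_in by (intro sum_mono extragradient_step) simp_all
  also have "\<dots> = real n * Z + W * (S2 + real n * N)"
    using sum_norm_diff_squared[of G "{1..n}" m "gvec st"] mean
    by (simp add: sum.distrib sum_distrib_left[symmetric] S2_def N_def)
  \<comment> \<open>The point \<open>x\<close> is fixed before the draw, so the products see only
    the mean of the estimators, which is the full gradient.\<close>
  also have "(\<Sum>i=1..n. a * inner (G i) (x - xstar) + a * (h x - h xstar)
        + 4 * \<beta> * (norm (xstar - prox_step X h \<beta> a (G i) (zpt st)))\<^sup>2) = real n * P + S1"
    by (simp add: sum.distrib sum_distrib_left[symmetric] inner_sum_left[symmetric] mean P_def S1_def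
        distrib_left del: One_nat_def)
  finally have extragradient: "real n * P + S1 \<le> real n * Z + W * (S2 + real n * N)" .

  have "(A + a + a\<^sup>2) * gap y + A / (2 * \<beta>) * grad_dist y (xbar st) + 8 * W * grad_dist y u
      \<le> A * gap (xbar st) + a\<^sup>2 * gap u + P"
    using coupling(2)[OF \<open>a > 0\<close> A(1) x st(1) \<open>u \<in> X\<close>] W
    by (simp add: P_def m_def y_def next_xbar_def A_def x_def)
  moreover have "2 * W * grad_dist y (xbar st) \<le> A / (2 * \<beta>) * grad_dist y (xbar st)"
    using W grad_dist_nonneg by (intro mult_right_mono) auto
  ultimately have "(A + a + a\<^sup>2) * gap y + 2 * W * grad_dist y (xbar st) + 8 * W * grad_dist y u
      \<le> A * gap (xbar st) + a\<^sup>2 * gap u + P"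
    by linarith
  then have coupled: "real n * ((A + a + a\<^sup>2) * gap y + 2 * W * grad_dist y (xbar st) + 8 * W * grad_dist y u)
      \<le> real n * (A * gap (xbar st) + a\<^sup>2 * gap u + P)"
    by (intro mult_left_mono) auto

  have "N \<le> 2 * (norm (m - full_grad (xbar st)))\<^sup>2 + 2 * M"
    unfolding N_def M_def by (rule norm_diff_squared_le)
  also have "(norm (m - full_grad (xbar st)))\<^sup>2 \<le> grad_dist y (xbar st)"
    unfolding m_def using euclid by (intro norm_full_grad_diff)
  finally have "W * (real n * N) \<le> W * (real n * (2 * grad_dist y (xbar st) + 2 * M))"
    using W by (intro mult_left_mono) auto
  moreover have "W * S2 \<le> W * (real n * grad_dist y u)"
    unfolding S2_def G_def m_def using W euclid by (intro mult_left_mono estimator_variance) simp_all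
  moreover have "0 \<le> W * (real n * grad_dist y u)"
    using W grad_dist_nonneg by simp
  moreover have "(\<Sum>i=1..n. lyapunov a (next_state a u k st (estimator b u (next_xbar a u st) i)))
      = real n * ((A + a + a\<^sup>2) * gap y) + S1 + 2 * W * S2"
    by (simp add: lyapunov_def potential_def next_state_def sum.distrib sum_distrib_left[symmetric]
        S1_def S2_def A_def y_def[symmetric] G_def[symmetric] m_def[symmetric] W(2))
  moreover have "lyapunov a st = A * gap (xbar st) + Z + 2 * W * M"
    by (simp add: lyapunov_def potential_def A_def Z_def M_def W(2))
  ultimately show ?thesis
    using extragradient coupled by (simp add: algebra_simps)
qed

lemma lyapunov_step:
  assumes "feasible st" "u \<in> X" "a > 0" "a\<^sup>2 \<le> 4 * Acoef st"
  shows "measure_pmf.expectation (vrae_step d n X f h \<beta> a T u t st) (lyapunov a)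
    \<le> lyapunov a st + a\<^sup>2 * gap u"
proof -
  have "measure_pmf.expectation (vrae_step d n X f h \<beta> a T u t st) (lyapunov a)
      = (\<Sum>i=1..n. lyapunov a (next_state a u (if t = T then n else 2) st
          (estimator (t = T) u (next_xbar a u st) i))) / real n"
    unfolding vrae_step_eq integral_map_pmf using n_pos by (subst integral_pmf_of_set) auto
  also have "\<dots> \<le> lyapunov a st + a\<^sup>2 * gap u"
    using lyapunov_step_average[OF assms] n_pos by (simp add: divide_le_eq mult.commute)
  finally show ?thesis .
qed

lemma vrae_step_support:
  assumes "feasible st" "u \<in> X" "a > 0" "Acoef st \<ge> 0"
    and "st' \<in> set_pmf (vrae_step d n X f h \<beta> a T u t st)"
  shows "feasible st'" "Acoef st' = Acoef st + a + a\<^sup>2"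
    "ngrads st' = ngrads st + (if t = T then n else 2)"
    "t = T \<Longrightarrow> gvec st' = full_grad (xbar st')"
proof -
  obtain i where i: "i \<in> {1..n}" and st': "st' = next_state a u (if t = T then n else 2) st
      (estimator (t = T) u (next_xbar a u st) i)"
    using assms(5) n_pos by (auto simp: vrae_step_eq set_pmf_of_set)
  have x: "next_xbar a u st \<in> X"
    using assms by (intro next_xbar_in)
  have g: "estimator (t = T) u (next_xbar a u st) i \<in> euclid d"
    by (rule estimator_in[OF i X_euclid[OF x] X_euclid[OF \<open>u \<in> X\<close>]])
  have "zpt st \<in> euclid d"
    using assms(1) X_euclid by (simp add: feasible_def)
  with g x show "feasible st'"
    using \<open>a > 0\<close> prox_step_in by (simp add: st' feasible_def next_state_def)
  show "Acoef st' = Acoef st + a + a\<^sup>2" "ngrads st' = ngrads st + (if t = T then n else 2)"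
    by (simp_all add: st' next_state_def)
  show "gvec st' = full_grad (xbar st')" if "t = T"
    using that by (simp add: st' next_state_def estimator_def)
qed


section \<open>Epochs\<close>

lemma finite_vrae_inner: "finite (set_pmf (vrae_inner d n X f h \<beta> a T u t st))"
  by (induction t) (auto simp: finite_vrae_step)

text \<open>These invariants hold on every sample path; in particular \<open>Acoef\<close> is
  deterministic. For a nonempty epoch the count is generous by 2 at \<open>t = T\<close>, where the
  exact gradient replaces a two-gradient draw.\<close>

lemma vrae_inner_support:
  assumes "feasible st" "u \<in> X" "a > 0" "Acoef st \<ge> 0" "t \<le> T"
    and "st' \<in> set_pmf (vrae_inner d n X f h \<beta> a T u t st)"
  shows "feasible st'" "Acoef st' = Acoef st + real t * (a + a\<^sup>2)"
    "ngrads st' \<le> ngrads st + 2 * t + (if t = T then n else 0)"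
    "0 < t \<Longrightarrow> t = T \<Longrightarrow> gvec st' = full_grad (xbar st')"
proof -
  have "feasible st' \<and> Acoef st' = Acoef st + real t * (a + a\<^sup>2) \<and>
    ngrads st' \<le> ngrads st + 2 * t + (if t = T then n else 0) \<and>
    (0 < t \<longrightarrow> t = T \<longrightarrow> gvec st' = full_grad (xbar st'))"
    using assms(5,6)
  proof (induction t arbitrary: st')
    case 0
    then show ?case using assms by simp
  next
    case (Suc t)
    then obtain st1 where st1: "st1 \<in> set_pmf (vrae_inner d n X f h \<beta> a T u t st)"
      and st': "st' \<in> set_pmf (vrae_step d n X f h \<beta> a T u (Suc t) st1)"
      by auto
    have IH: "feasible st1" "Acoef st1 = Acoef st + real t * (a + a\<^sup>2)" "ngrads st1 \<le> ngrads st + 2 * t"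
      using Suc.IH[OF _ st1] Suc.prems(1) by auto
    have "Acoef st1 \<ge> 0"
      using IH assms by simp
    note step = vrae_step_support[OF IH(1) assms(2,3) this st']
    show ?case
      using step IH by (auto simp: algebra_simps)
  qed
  then show "feasible st'" "Acoef st' = Acoef st + real t * (a + a\<^sup>2)"
    "ngrads st' \<le> ngrads st + 2 * t + (if t = T then n else 0)"
    "0 < t \<Longrightarrow> t = T \<Longrightarrow> gvec st' = full_grad (xbar st')"
    by blast+
qed

text \<open>The anchor is fixed throughout the epoch, so each step adds the same constant, and
  \<open>a\<^sup>2 \<le> 4 * Acoef\<close> persists because \<open>Acoef\<close> only grows.\<close>

lemma vrae_inner_lyapunov:
  assumes "feasible st" "u \<in> X" "a > 0" "a\<^sup>2 \<le> 4 * Acoef st" "t \<le> T"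
  shows "measure_pmf.expectation (vrae_inner d n X f h \<beta> a T u t st) (lyapunov a)
    \<le> lyapunov a st + real t * (a\<^sup>2 * gap u)"
  using assms(5)
proof (induction t)
  case (Suc t)
  have A: "Acoef st \<ge> 0"
    using assms(4) zero_le_power2[of a] by linarith
  have "measure_pmf.expectation (vrae_inner d n X f h \<beta> a T u (Suc t) st) (lyapunov a)
      \<le> measure_pmf.expectation (vrae_inner d n X f h \<beta> a T u t st) (\<lambda>st. lyapunov a st + a\<^sup>2 * gap u)"
    unfolding vrae_inner.simps
  proof (rule expectation_bind_le[OF finite_vrae_inner finite_vrae_step lyapunov_step])
    fix st1 assume st1: "st1 \<in> set_pmf (vrae_inner d n X f h \<beta> a T u t st)"
    have "t \<le> T" using Suc.prems by simp
    note sup = vrae_inner_support[OF assms(1-3) A this st1]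
    show "feasible st1" by (rule sup)
    have "0 \<le> real t * (a + a\<^sup>2)"
      using assms by simp
    then have "Acoef st \<le> Acoef st1"
      unfolding sup(2) by simp
    then show "a\<^sup>2 \<le> 4 * Acoef st1"
      using assms(4) by linarith
  qed (use assms in auto)
  also have "\<dots> = measure_pmf.expectation (vrae_inner d n X f h \<beta> a T u t st) (lyapunov a) + a\<^sup>2 * gap u"
    by (simp add: integrable_measure_pmf_finite finite_vrae_inner)
  also have "\<dots> \<le> lyapunov a st + real (Suc t) * (a\<^sup>2 * gap u)"
    using Suc by (simp add: algebra_simps)
  finally show ?case .
qed simp

lemma finite_vrae_epoch: "finite (set_pmf (vrae_epoch d n X f h \<beta> a T st))"
  by (simp add: vrae_epoch_def finite_vrae_inner)

lemma vrae_epoch_support: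
  assumes "feasible st" "a > 0" "real T * a\<^sup>2 \<le> Acoef st" "T \<ge> 1"
    and "st' \<in> set_pmf (vrae_epoch d n X f h \<beta> a T st)"
  shows "feasible st'" "Acoef st' = Acoef st + real T * a" "ngrads st' \<le> ngrads st + (2 * T + n)"
    "gvec st' = full_grad (xbar st')"
proof -
  let ?st = "st\<lparr>Acoef := Acoef st - real T * a\<^sup>2\<rparr>"
  have "feasible ?st" "xbar st \<in> X" "Acoef ?st \<ge> 0"
    using assms by (auto simp: feasible_def)
  note sup = vrae_inner_support[OF this(1,2) assms(2) this(3) order_refl assms(5)[unfolded vrae_epoch_def]]
  show "feasible st'" "Acoef st' = Acoef st + real T * a" "ngrads st' \<le> ngrads st + (2 * T + n)"
    "gvec st' = full_grad (xbar st')"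
    using sup assms by (auto simp: algebra_simps)
qed

text \<open>The exact gradient at the end of an epoch makes the error term of the Lyapunov function vanish
  at the start of the next one, and the weight \<open>T a\<^sup>2\<close> taken off \<open>A\<close> pays for the anchor terms.\<close>

lemma vrae_epoch_potential:
  assumes "feasible st" "gvec st = full_grad (xbar st)" "a > 0" "real T * a\<^sup>2 + a\<^sup>2 / 4 \<le> Acoef st"
  shows "measure_pmf.expectation (vrae_epoch d n X f h \<beta> a T st) potential \<le> potential st"
proof -
  let ?st = "st\<lparr>Acoef := Acoef st - real T * a\<^sup>2\<rparr>"
  have "measure_pmf.expectation (vrae_epoch d n X f h \<beta> a T st) potential
      \<le> measure_pmf.expectation (vrae_epoch d n X f h \<beta> a T st) (lyapunov a)"
    using beta_pos
    by (intro integral_mono integrable_measure_pmf_finite finite_vrae_epoch) (simp add: lyapunov_def)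
  \<comment> \<open>The reserve \<open>a\<^sup>2 / 4\<close> in the hypothesis is what the reduced
    coefficient must retain for \<open>a\<^sup>2 \<le> 4 * Acoef ?st\<close>.\<close>
  also have "\<dots> \<le> lyapunov a ?st + real T * (a\<^sup>2 * gap (xbar st))"
    unfolding vrae_epoch_def using assms
    by (intro vrae_inner_lyapunov) (auto simp: feasible_def)
  also have "\<dots> = potential st"
    using assms(2) by (simp add: lyapunov_def potential_def algebra_simps)
  finally show ?thesis .
qed

lemma finite_vrae: "finite (set_pmf (vrae d n X f h \<beta> a T A0 u0 s))"
  by (induction s) (auto simp: finite_vrae_epoch)

section \<open>Whole runs with general parameters\<close>

context
  fixes a :: "nat \<Rightarrow> real" and T :: "nat \<Rightarrow> nat" and A0 :: real and u0 :: evec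
    and A :: "nat \<Rightarrow> real"
  defines "A \<equiv> \<lambda>s. A0 + (\<Sum>j=1..s. real (T j) * a j)"
  assumes u0: "u0 \<in> X" and a_pos: "\<And>s. a (Suc s) > 0" and T_pos: "\<And>s. T (Suc s) \<ge> 1"
    and A_ge: "\<And>s. real (T (Suc s)) * (a (Suc s))\<^sup>2 + (a (Suc s))\<^sup>2 / 4 \<le> A s"
begin

lemma vrae_support:
  assumes "st \<in> set_pmf (vrae d n X f h \<beta> a T A0 u0 s)"
  shows "feasible st \<and> gvec st = full_grad (xbar st) \<and> Acoef st = A s \<and>
    ngrads st \<le> n + (\<Sum>j=1..s. 2 * T j + n)"
  using assms
proof (induction s arbitrary: st)
  case 0
  then show ?case
    using u0 full_grad_in[OF X_euclid[OF u0]] by (simp add: feasible_def A_def)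
next
  case (Suc s)
  then obtain st1 where st1: "st1 \<in> set_pmf (vrae d n X f h \<beta> a T A0 u0 s)"
    and st: "st \<in> set_pmf (vrae_epoch d n X f h \<beta> (a (Suc s)) (T (Suc s)) st1)"
    by auto
  note IH = Suc.IH[OF st1]
  have "real (T (Suc s)) * (a (Suc s))\<^sup>2 \<le> Acoef st1"
    using A_ge[of s] IH zero_le_power2[of "a (Suc s)"] by linarith
  note sup = vrae_epoch_support[OF _ a_pos this T_pos st]
  show ?case
    using IH sup by (auto simp: A_def)
qed

lemma vrae_potential:
  "measure_pmf.expectation (vrae d n X f h \<beta> a T A0 u0 s) potential
    \<le> A0 * gap u0 + 4 * \<beta> * (norm (u0 - xstar))\<^sup>2"
proof (induction s)
  case 0
  then show ?case
    by (simp add: potential_def norm_minus_commute)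
next
  case (Suc s)
  have "measure_pmf.expectation (vrae d n X f h \<beta> a T A0 u0 (Suc s)) potential
      \<le> measure_pmf.expectation (vrae d n X f h \<beta> a T A0 u0 s) potential"
    unfolding vrae.simps
  proof (rule expectation_bind_le[OF finite_vrae finite_vrae_epoch vrae_epoch_potential])
    fix st assume "st \<in> set_pmf (vrae d n X f h \<beta> a T A0 u0 s)"
    from vrae_support[OF this] show "feasible st" "gvec st = full_grad (xbar st)"
      "real (T (Suc s)) * (a (Suc s))\<^sup>2 + (a (Suc s))\<^sup>2 / 4 \<le> Acoef st"
      using A_ge[of s] by auto
  qed (rule a_pos)
  also note Suc
  finally show ?case .
qed

lemma vrae_expected_gap:
  "A s * measure_pmf.expectation (vrae d n X f h \<beta> a T A0 u0 s) (\<lambda>st. gap (xbar st))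
    \<le> A0 * gap u0 + 4 * \<beta> * (norm (u0 - xstar))\<^sup>2"
proof -
  let ?run = "vrae d n X f h \<beta> a T A0 u0 s"
  have "A s * measure_pmf.expectation ?run (\<lambda>st. gap (xbar st))
      = measure_pmf.expectation ?run (\<lambda>st. A s * gap (xbar st))"
    by simp
  \<comment> \<open>On the support \<open>Acoef st\<close> is the number \<open>A s\<close>, so only
    the distance term is dropped.\<close>
  also have "\<dots> \<le> measure_pmf.expectation ?run potential"
    using vrae_support beta_pos
    by (intro integral_mono_AE integrable_measure_pmf_finite finite_vrae)
      (auto simp: AE_measure_pmf_iff potential_def)
  also note vrae_potential
  finally show ?thesis .
qed

end

end


section \<open>The parameter choice\<close>

text \<open>\<open>s0\<close> extended to real arguments, so that it can also be evaluated at the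
  ratio of \<open>V\<close> to the accuracy.\<close>

definition ceil_log_log :: "real \<Rightarrow> nat" where
  "ceil_log_log x = nat \<lceil>log 2 (log 2 (4 * x))\<rceil>"

lemma s0_eq: "s0 n = ceil_log_log (real n)"
  by (simp add: s0_def ceil_log_log_def)

lemma log_4_ge_2:
  assumes "x \<ge> 1"
  shows "log 2 (4 * x) \<ge> 2"
  using assms by (subst le_log_iff) auto

lemma ceil_log_log_ge_1:
  assumes "x \<ge> 1"
  shows "ceil_log_log x \<ge> 1"
proof -
  have "log 2 (log 2 (4 * x)) \<ge> 1"
    using log_4_ge_2[OF assms] by (subst le_log_iff) auto
  then show ?thesis
    unfolding ceil_log_log_def by linarith
qed

lemma ceil_log_log_mono:
  assumes "1 \<le> x" "x \<le> y"
  shows "ceil_log_log x \<le> ceil_log_log y"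
  unfolding ceil_log_log_def
  using assms log_4_ge_2[of x] by (intro nat_mono ceiling_mono log_mono) auto

text \<open>The rounding up gives \<open>2 ^ s \<ge> log 2 (4 * x)\<close> for this
  \<open>s\<close>, so the root of order \<open>2 ^ s\<close> of \<open>4 * x\<close> is at most
  2.\<close>

lemma ceil_log_log_powr:
  assumes "x \<ge> 1"
  shows "(4 * x) powr (- ((1 / 2) ^ ceil_log_log x)) \<ge> 1 / 2"
proof -
  let ?s = "ceil_log_log x"
  have "log 2 (log 2 (4 * x)) \<le> real ?s"
    unfolding ceil_log_log_def by linarith
  then have "log 2 (4 * x) \<le> 2 powr real ?s"
    using log_4_ge_2[OF assms] by (simp add: log_le_iff)
  then have "(1 / 2) ^ ?s * log 2 (4 * x) \<le> 1"
    by (simp add: powr_realpow power_one_over field_simps)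
  then have "2 powr (- 1) \<le> 2 powr (log 2 (4 * x) * - ((1 / 2) ^ ?s))"
    by (intro powr_mono) (simp_all add: mult.commute)
  also have "\<dots> = (4 * x) powr (- ((1 / 2) ^ ?s))"
    unfolding powr_powr[symmetric] using assms by simp
  finally show ?thesis by simp
qed

lemma loglog_ge_1: "loglog x \<ge> 1"
  by (simp add: loglog_def)

text \<open>Write \<open>L\<close> for \<open>loglog x\<close>, so \<open>L \<ge> 1\<close>. Since
  \<open>ln 2 \<ge> 1 / 2\<close>, the inner logarithm is at most
  \<open>2 + 2 * exp L \<le> 4 * exp L\<close> and the outer one at most
  \<open>2 + 2 * L \<le> 4 * L\<close>; rounding up adds at most one more \<open>L\<close>.\<close>

lemma ceil_log_log_le:
  assumes "x \<ge> 1"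
  shows "real (ceil_log_log x) \<le> 5 * loglog x"
proof -
  let ?L = "loglog x"
  have "exp 1 \<le> (4 :: real)"
    using exp_le by simp
  then have "ln (exp 1) \<le> ln ((2::real)\<^sup>2)"
    by (subst ln_le_cancel_iff) auto
  moreover have ln4: "ln (4::real) = 2 * ln 2"
    using ln_realpow[of "2::real" 2] by simp
  ultimately have ln2: "1 / 2 \<le> ln (2::real)"
    by simp
  have half: "y / ln 2 \<le> 2 * y" if "y \<ge> 0" for y :: real
  proof -
    have "y * 1 \<le> y * (2 * ln 2)"
      using ln2 that by (intro mult_left_mono) auto
    then show ?thesis
      using ln2 by (simp add: divide_le_eq mult_ac)
  qed
  have L: "1 \<le> ?L"
    by (rule loglog_ge_1)
  have "ln x \<le> exp ?L"
  proof (cases "x > 1")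
    case True
    then have "ln x = exp (ln (ln x))" by simp
    also have "\<dots> \<le> exp ?L"
      unfolding exp_le_cancel_iff using True by (simp add: loglog_def)
    finally show ?thesis .
  qed (use assms in auto)
  moreover have "log 2 (4 * x) = 2 + ln x / ln 2"
    using assms by (simp add: log_def ln_mult ln4 add_divide_distrib)
  moreover have "ln x / ln 2 \<le> 2 * ln x"
    using assms by (intro half) auto
  moreover have "1 \<le> exp ?L"
    using L by simp
  ultimately have "log 2 (4 * x) \<le> 4 * exp ?L" by linarith
  then have "log 2 (log 2 (4 * x)) \<le> log 2 (4 * exp ?L)"
    using log_4_ge_2[OF assms] by (intro log_mono) auto
  also have "\<dots> = 2 + ?L / ln 2"
    by (simp add: log_def ln_mult ln4 add_divide_distrib)
  also have "\<dots> \<le> 4 * ?L"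
    using half[of ?L] L by linarith
  finally show ?thesis
    using L unfolding ceil_log_log_def by linarith
qed

section \<open>Step sizes and the accumulated weight\<close>

lemma a_param_early: "s \<le> s0 n \<Longrightarrow> a_param n s = (4 * real n) powr (- ((1 / 2) ^ s))"
  by (simp add: a_param_def)

lemma a_param_late: "a_param n (s0 n + Suc k) = (real k + 3 / 2) / 3"
  by (simp add: a_param_def Let_def)

lemma a_param_pos:
  assumes "n \<ge> 1"
  shows "a_param n s > 0"
  using assms by (auto simp: a_param_def Let_def)

text \<open>The exponents halve, so each early step size is the square root of the previous one: the
  weight taken off at the start of an epoch equals the weight added by the epoch before it, if there
  is one.\<close>

lemma a_param_Suc_squared:
  assumes "Suc s \<le> s0 n"
  shows "(a_param n (Suc s))\<^sup>2 = (4 * real n) powr (- ((1 / 2) ^ s))"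
proof -
  have "- ((1 / 2 :: real) ^ s) = - ((1 / 2) ^ Suc s) + - ((1 / 2) ^ Suc s)"
    by simp
  then show ?thesis
    unfolding a_param_early[OF assms] power2_eq_square by (simp only: powr_add)
qed

definition A_param :: "nat \<Rightarrow> nat \<Rightarrow> real" where
  "A_param n s = 5 / 4 + (\<Sum>j=1..s. real n * a_param n j)"

lemma A_param_ge:
  assumes "n \<ge> 1" "s \<ge> 1"
  shows "A_param n s \<ge> 5 / 4 + real n * a_param n s"
proof -
  have "real n * a_param n s \<le> (\<Sum>j=1..s. real n * a_param n j)"
    using assms a_param_pos[OF assms(1)]
    by (intro member_le_sum) (auto intro: less_imp_le)
  then show ?thesis
    by (simp add: A_param_def)
qed

text \<open>The last early epoch alone contributes \<open>n / 2\<close>. Passing from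
  \<open>k\<close> to \<open>k + 1\<close> raises the quadratic by \<open>(2 * k + 3) / 6\<close>,
  exactly the late step size.\<close>

lemma A_param_late:
  assumes "n \<ge> 1"
  shows "A_param n (s0 n + k) \<ge> 5 / 4 + real n * (1 / 2 + (real k ^ 2 + 2 * real k) / 6)"
proof (induction k)
  case 0
  have "1 \<le> s0 n" "1 / 2 \<le> a_param n (s0 n)"
    using assms ceil_log_log_ge_1[of "real n"] ceil_log_log_powr[of "real n"]
    by (simp_all add: s0_eq[symmetric] a_param_early)
  then have "real n * (1 / 2) \<le> real n * a_param n (s0 n)"
    by (intro mult_left_mono) auto
  with A_param_ge[OF assms \<open>1 \<le> s0 n\<close>] show ?case by simp
next
  case (Suc k)
  have "A_param n (s0 n + Suc k) = A_param n (s0 n + k) + real n * ((real k + 3 / 2) / 3)"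
    using a_param_late[of n k] by (simp add: A_param_def)
  then show ?case
    using Suc by (simp add: field_simps power2_eq_square)
qed

text \<open>In early epochs \<open>n\<close> times the squared step is the weight added by the
  preceding epoch, or \<open>1 / 4\<close> if there is none, and the initial \<open>5 / 4\<close>
  covers the rest. In late epochs two quadratics in \<open>k\<close> are compared.\<close>

lemma A_param_dominates:
  assumes "n \<ge> 1"
  shows "real n * (a_param n (Suc s))\<^sup>2 + (a_param n (Suc s))\<^sup>2 / 4 \<le> A_param n s"
proof (cases "Suc s \<le> s0 n")
  case early: True
  define b where "b = (4 * real n) powr (- ((1 / 2) ^ s))"
  have "b \<le> (4 * real n) powr 0"
    unfolding b_def using assms by (intro powr_mono) auto
  then have b: "b \<le> 1"
    using assms by simp
  have "real n * b + b / 4 \<le> A_param n s"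
  proof (cases "s = 0")
    case True
    then have "b = 1 / (4 * real n)"
      using assms by (simp add: b_def powr_minus_divide)
    then have "real n * b = 1 / 4"
      using assms by simp
    then show ?thesis
      using b True by (simp add: A_param_def)
  next
    case False
    then have "A_param n s \<ge> 5 / 4 + real n * b"
      using A_param_ge[OF assms, of s] early by (simp add: a_param_early b_def)
    with b show ?thesis by simp
  qed
  then show ?thesis
    unfolding a_param_Suc_squared[OF early] b_def .
next
  case False
  then obtain k where s: "s = s0 n + k"
    using le_Suc_ex by (metis not_less_eq_eq)
  \<comment> \<open>Apart from the initial \<open>5 / 4\<close>, the lower bound on the weight
    exceeds \<open>n\<close> times the squared step by \<open>n * (1 / 4 + k^2 / 18)\<close>. The
    square in the next fact gives \<open>k / 12 \<le> k^2 / 36 + 1 / 16\<close>, the estimate for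
    the remaining quarter of the squared step.\<close>
  have "1 * (1 / 4 + (real k)\<^sup>2 / 18) \<le> real n * (1 / 4 + (real k)\<^sup>2 / 18)"
    using assms by (intro mult_right_mono) auto
  moreover have "0 \<le> (real k - 3 / 2)\<^sup>2" by simp
  ultimately have "real n * ((real k + 3 / 2) / 3)\<^sup>2 + ((real k + 3 / 2) / 3)\<^sup>2 / 4
      \<le> 5 / 4 + real n * (1 / 2 + (real k ^ 2 + 2 * real k) / 6)"
    by (simp add: power2_eq_square field_simps)
  also have "\<dots> \<le> A_param n s"
    unfolding s by (rule A_param_late[OF assms])
  also have "(real k + 3 / 2) / 3 = a_param n (Suc s)"
    using a_param_late[of n k] by (simp add: s)
  finally show ?thesis .
qed

text \<open>For \<open>1 \<le> x \<le> n\<close> the map \<open>y \<mapsto> y (4 y) powr (-\<delta>)\<close> is increasing, so the first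
  \<open>ceil_log_log x\<close> epochs for \<open>n\<close> do at least as well as they would for \<open>x\<close> components.\<close>

lemma A_param_early_ge:
  assumes "1 \<le> x" "x \<le> real n"
  shows "A_param n (ceil_log_log x) \<ge> x / 2"
proof -
  let ?s = "ceil_log_log x"
  define \<delta> where "\<delta> = (1 / 2 :: real) ^ ?s"
  have n: "n \<ge> 1"
    using assms by simp
  have \<delta>: "\<delta> \<le> 1"
    by (simp add: \<delta>_def power_le_one)
  have scale: "y * (4 * y) powr (- \<delta>) = 4 powr (- \<delta>) * y powr (1 - \<delta>)" if "y > 0" for y :: real
    using that by (simp add: powr_mult powr_diff powr_minus divide_inverse)
  have "x * (1 / 2) \<le> x * (4 * x) powr (- \<delta>)"
    unfolding \<delta>_def using assms ceil_log_log_powr[OF assms(1)] by (intro mult_left_mono) auto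
  also have "\<dots> \<le> real n * (4 * real n) powr (- \<delta>)"
    using assms \<delta> by (simp add: scale powr_mono2)
  also have "\<dots> = real n * a_param n ?s"
    using ceil_log_log_mono[OF assms] by (simp add: a_param_early s0_eq \<delta>_def)
  also have "\<dots> \<le> A_param n ?s"
    using A_param_ge[OF n ceil_log_log_ge_1[OF assms(1)]] by simp
  finally show ?thesis by simp
qed

text \<open>Here \<open>r\<close> stands for \<open>V / \<epsilon>\<close>. For
  \<open>r \<le> n\<close> early epochs suffice; otherwise all \<open>s0 n\<close> of them are
  followed by about \<open>sqrt (3 * r / n)\<close> late ones. The factor \<open>4 * n\<close> is
  the charge per epoch.\<close>

lemma enough_epochs:
  assumes "n \<ge> 1"
  obtains S where "S \<ge> 1" "A_param n S \<ge> r / 2"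
    "4 * real n * real S \<le> 24 * (if r \<le> real n then real n * loglog r
       else real n * loglog (real n) + sqrt (r * real n))"
proof (cases "r \<le> real n")
  case True
  \<comment> \<open>The ratio may be below 1, even 0. Raising it to 1 leaves \<open>loglog\<close>
    unchanged, since its value there is 1 as well.\<close>
  let ?S = "ceil_log_log (max 1 r)"
  have "loglog (max 1 r) = loglog r"
    by (simp add: loglog_def max_def)
  then have "real ?S \<le> 5 * loglog r"
    using ceil_log_log_le[of "max 1 r"] by simp
  then have "4 * real n * real ?S \<le> 4 * real n * (6 * loglog r)"
    using loglog_ge_1[of r] by (intro mult_left_mono) auto
  moreover have "r / 2 \<le> max 1 r / 2" by simp
  then have "A_param n ?S \<ge> r / 2"
    using A_param_early_ge[of "max 1 r" n] True assms by linarith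
  ultimately show thesis
    using that[of ?S] ceil_log_log_ge_1[of "max 1 r"] True by simp
next
  case False
  \<comment> \<open>With this \<open>w\<close> the quadratic term alone reaches the target:
    \<open>n * w^2 / 6 = r / 2\<close>.\<close>
  define w where "w = sqrt (3 * r / real n)"
  define k where "k = nat \<lceil>w\<rceil>"
  have n: "real n \<ge> 1"
    using assms by simp
  have r: "r > 0"
    using False n by simp
  have w: "w \<ge> 0" "w\<^sup>2 = 3 * r / real n"
    using r by (auto simp: w_def)
  have k: "w \<le> real k" "real k \<le> w + 1"
    unfolding k_def using w(1) by linarith+
  have k_sq: "w\<^sup>2 / 6 \<le> 1 / 2 + (real k ^ 2 + 2 * real k) / 6"
    using power_mono[OF k(1) w(1), of 2] by (simp add: field_simps add_increasing)
  have "r / 2 = real n * (w\<^sup>2 / 6)"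
    using n w by simp
  also have "\<dots> \<le> real n * (1 / 2 + (real k ^ 2 + 2 * real k) / 6)"
    using k_sq by (intro mult_left_mono) auto
  also have "\<dots> \<le> A_param n (s0 n + k)"
    using A_param_late[OF assms, of k] by linarith
  finally have A: "A_param n (s0 n + k) \<ge> r / 2" .
  have "real n * w = sqrt 3 * sqrt (r * real n)"
    using n by (simp add: w_def real_sqrt_mult real_sqrt_divide field_simps)
  also have "\<dots> \<le> 6 * sqrt (r * real n)"
    using r by (intro mult_right_mono real_le_lsqrt) auto
  finally have nw: "real n * w \<le> 6 * sqrt (r * real n)" .
  \<comment> \<open>Five multiples come from \<open>s0\<close>; the sixth absorbs the rounding of
    \<open>w\<close>.\<close>
  have "real (s0 n + k) \<le> 6 * loglog (real n) + w"
    using ceil_log_log_le[OF n] k loglog_ge_1[of "real n"] by (simp add: s0_eq)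
  then have "4 * real n * real (s0 n + k) \<le> 4 * real n * (6 * loglog (real n) + w)"
    by (intro mult_left_mono) auto
  also have "\<dots> \<le> 24 * (real n * loglog (real n) + sqrt (r * real n))"
    using nw by (simp add: algebra_simps)
  finally have "4 * real n * real (s0 n + k) \<le> 24 * (real n * loglog (real n) + sqrt (r * real n))" .
  moreover have "s0 n + k \<ge> 1"
    using ceil_log_log_ge_1[OF n] by (simp add: s0_eq)
  ultimately show thesis
    using that[of "s0 n + k"] A False by simp
qed


section \<open>Complexity\<close>

context vrae_problem
begin

lemma vrae_complexity:
  assumes "u0 \<in> X" "\<epsilon> > 0"
  defines "V \<equiv> 5 / 2 * gap u0 + 8 * \<beta> * (norm (u0 - xstar))\<^sup>2"
  obtains S where "S \<ge> 1"
    "measure_pmf.expectation (vrae d n X f h \<beta> (a_param n) (\<lambda>_. n) (5 / 4) u0 S) (\<lambda>st. gap (xbar st)) \<le> \<epsilon>"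
    "\<And>st. st \<in> set_pmf (vrae d n X f h \<beta> (a_param n) (\<lambda>_. n) (5 / 4) u0 S) \<Longrightarrow>
      real (ngrads st) \<le> 24 * (if \<epsilon> \<ge> V / real n then real n * loglog (V / \<epsilon>)
        else real n * loglog (real n) + sqrt (V * real n / \<epsilon>))"
proof -
  have V: "V \<ge> 0"
    unfolding V_def using gap_nonneg[OF assms(1)] beta_pos by simp
  obtain S where S: "S \<ge> 1" "A_param n S \<ge> (V / \<epsilon>) / 2"
    and count: "4 * real n * real S \<le> 24 * (if V / \<epsilon> \<le> real n then real n * loglog (V / \<epsilon>)
       else real n * loglog (real n) + sqrt (V / \<epsilon> * real n))"
    using enough_epochs[OF n_pos] .
  let ?run = "vrae d n X f h \<beta> (a_param n) (\<lambda>_. n) (5 / 4) u0 S"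
  note params = \<open>u0 \<in> X\<close> a_param_pos[OF n_pos] n_pos A_param_dominates[OF n_pos, unfolded A_param_def]
  have "A_param n S > 0"
    using a_param_pos[OF n_pos, of S]
    by (intro less_le_trans[OF _ A_param_ge[OF n_pos S(1)]] add_pos_nonneg) simp_all
  \<comment> \<open>The initial potential, with weight \<open>5 / 4\<close>, is
    \<open>V / 2\<close>.\<close>
  moreover have "A_param n S * measure_pmf.expectation ?run (\<lambda>st. gap (xbar st)) \<le> V / 2"
    using vrae_expected_gap[OF params, of S] by (simp add: A_param_def V_def)
  moreover have "V / 2 \<le> A_param n S * \<epsilon>"
    using S(2) \<open>\<epsilon> > 0\<close> by (simp add: field_simps)
  ultimately have gap: "measure_pmf.expectation ?run (\<lambda>st. gap (xbar st)) \<le> \<epsilon>"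
    by (meson mult_le_cancel_left_pos order_trans)
  have "real (ngrads st) \<le> 24 * (if \<epsilon> \<ge> V / real n then real n * loglog (V / \<epsilon>)
      else real n * loglog (real n) + sqrt (V * real n / \<epsilon>))" if "st \<in> set_pmf ?run" for st
  proof -
    have "ngrads st \<le> n + (\<Sum>j=1..S. 2 * n + n)"
      using vrae_support[OF params that] by blast
    \<comment> \<open>The \<open>n\<close> gradients of the initialization are charged to the first
      epoch, which exists because \<open>S \<ge> 1\<close>.\<close>
    also have "\<dots> \<le> 4 * n * S"
      using S(1) by (cases S) (simp_all add: algebra_simps)
    finally have "real (ngrads st) \<le> real (4 * n * S)"
      by (rule of_nat_mono)
    then have le: "real (ngrads st) \<le> 4 * real n * real S"
      by simp
    have iff: "V / \<epsilon> \<le> real n \<longleftrightarrow> \<epsilon> \<ge> V / real n"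
      using n_pos \<open>\<epsilon> > 0\<close> by (simp add: field_simps)
    show ?thesis
      using order_trans[OF le count] unfolding iff times_divide_eq_left .
  qed
  with S(1) gap show thesis by (rule that)
qed

end

theorem theoremC1:
  shows "\<exists>C::real>0. \<forall>(d::nat) (n::nat) (X :: evec set) (f :: nat \<Rightarrow> evec \<Rightarrow> real) (h :: evec \<Rightarrow> real)
           (\<beta>::real) (u0::evec) (xstar::evec) (\<epsilon>::real).
    problem d n X f h \<beta> \<longrightarrow> u0 \<in> X \<longrightarrow>
    is_arg_min (objective n f h) (\<lambda>x. x \<in> X) xstar \<longrightarrow> \<epsilon> > 0 \<longrightarrow>
    (let V = 5 / 2 * (objective n f h u0 - objective n f h xstar) + 8 * \<beta> * (norm (u0 - xstar))\<^sup>2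
     in \<exists>S\<ge>1.
       (let run = vrae d n X f h \<beta> (a_param n) (\<lambda>_. n) (5 / 4) u0 S in
         measure_pmf.expectation run
           (\<lambda>st. objective n f h (xbar st) - objective n f h xstar) \<le> \<epsilon> \<and>
         (\<forall>st\<in>set_pmf run. real (ngrads st) \<le>
            C * (if \<epsilon> \<ge> V / real n then real n * loglog (V / \<epsilon>)
                 else real n * loglog (real n) + sqrt (V * real n / \<epsilon>)))))"
\<comment> \<open>\<open>24\<close> is the charge \<open>4 * n\<close> per epoch, up to
  \<open>n\<close>, times the factor 6 in the bound on the number of epochs.\<close>
proof (intro exI[of _ "24::real"] conjI allI impI)
  fix d n :: nat and X f h \<beta> u0 xstar and \<epsilon> :: real
  assume "problem d n X f h \<beta>" "u0 \<in> X" "is_arg_min (objective n f h) (\<lambda>x. x \<in> X) xstar" "\<epsilon> > 0"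
  then interpret vrae_problem d n X f h \<beta> xstar
    by unfold_locales
  show "let V = 5 / 2 * (objective n f h u0 - objective n f h xstar) + 8 * \<beta> * (norm (u0 - xstar))\<^sup>2
     in \<exists>S\<ge>1.
       (let run = vrae d n X f h \<beta> (a_param n) (\<lambda>_. n) (5 / 4) u0 S in
         measure_pmf.expectation run
           (\<lambda>st. objective n f h (xbar st) - objective n f h xstar) \<le> \<epsilon> \<and>
         (\<forall>st\<in>set_pmf run. real (ngrads st) \<le>
            24 * (if \<epsilon> \<ge> V / real n then real n * loglog (V / \<epsilon>)
                 else real n * loglog (real n) + sqrt (V * real n / \<epsilon>))))"
    using vrae_complexity[OF \<open>u0 \<in> X\<close> \<open>\<epsilon> > 0\<close>] unfolding gap_def Let_def by metis
qed simp

end
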